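(* Let $(X,d)$ be a compact metric space and $T:X\to X$ a map that is Lipschitz with respect to $d$ and has positive topological entropy. Then there exist $C,\alpha>0$ such that for all $0<\epsilon<1$, $$\mathrm{mdim}_{W_1}(T_*,\epsilon)\ge C\epsilon^{-\alpha}.$$
   Context: $\mathcal{M}(X)$ is the space of Borel probability measures on $X$ with the weak-$*$ topology, and $T_*\mu=\mu\circ T^{-1}$. $W_1$ is the $1$-Wasserstein distance on $\mathcal{M}(X)$ associated to $d$: $W_1(\mu,\nu)=\inf_{\gamma}\int d(x,y)\,d\gamma(x,y)$, the infimum over all Borel probability measures $\gamma$ on $X\times X$ with marginals $\mu$ and $\nu$. For a compact metric space $(Y,\rho)$ and $\epsilon>0$, a map $f:Y\to Z$ is $(\rho,\epsilon)$-injective if $\mathrm{diam}_\rho(f^{-1}(z))<\epsilon$ for all $z\in Z$; $\dim_\epsilon(Y,\rho)$ is the infimum of the topological (covering) dimensions $\dim(Z)$ over all compact metrizable spaces $Z$ admitting a $(\rho,\epsilon)$-injective continuous map $f:Y\to Z$. For continuous $S:Y\to Y$ let $\rho_n(x,y)=\max_{0\le i\le n-1}\rho(S^ix,S^iy)$ and $\mathrm{mdim}_\rho(S,\epsilon)=\lim_{n\to\infty}\frac1n\dim_\epsilon(Y,\rho_n)$. Here this is applied to $Y=\mathcal{M}(X)$, $\rho=W_1$, $S=T_*$.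
   Formalization: The bound is stated for all 0<ε<ε₀, with some ε₀>0 depending on (X,d,T), instead of for all 0<ε<1, since the latter fails when diam(X) is small (e.g. a full shift of diameter 1/10 has mdim 0 at ε=1/2). *)

theory Defs
  imports "HOL-Probability.Probability"
begin

section \<open>Dynamical metrics and topological entropy\<close>

text \<open>Only the values at \<open>n \<ge> 1\<close> are meaningful; \<open>n = 0\<close> is irrelevant for the limits below.\<close>

definition dyn_metric :: "('y \<Rightarrow> 'y) \<Rightarrow> ('y \<Rightarrow> 'y \<Rightarrow> real) \<Rightarrow> nat \<Rightarrow> 'y \<Rightarrow> 'y \<Rightarrow> real" where
  "dyn_metric S \<rho> n x y = (MAX i\<in>{..<n}. \<rho> ((S ^^ i) x) ((S ^^ i) y))"

definition separated :: "('a::metric_space \<Rightarrow> 'a) \<Rightarrow> nat \<Rightarrow> real \<Rightarrow> 'a set \<Rightarrow> bool" where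
  "separated T n \<epsilon> E \<longleftrightarrow> (\<forall>x\<in>E. \<forall>y\<in>E. x \<noteq> y \<longrightarrow> dyn_metric T dist n x y > \<epsilon>)"

text \<open>Bowen's definition, for a continuous self-map of a compact metric space. The growth rate
  of separated sets increases as \<open>\<epsilon>\<close> decreases, so its limit for \<open>\<epsilon> \<rightarrow> 0\<close> is the supremum over
  \<open>\<epsilon> > 0\<close>.\<close>

definition topological_entropy :: "('a::metric_space \<Rightarrow> 'a) \<Rightarrow> ereal" where
  "topological_entropy T =
     (SUP \<epsilon>\<in>{0<..}. limsup (\<lambda>n.
        ereal (1 / real n) *
        (SUP E\<in>{E. finite E \<and> separated T n \<epsilon> E}. ereal (ln (real (card E))))))"

section \<open>Covering dimension and metric mean dimension at a scale\<close>

definition covering_dim_le :: "'z topology \<Rightarrow> int \<Rightarrow> bool" where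
  "covering_dim_le Z n \<longleftrightarrow>
     (\<forall>\<U>. finite \<U> \<and> (\<forall>U\<in>\<U>. openin Z U) \<and> \<Union>\<U> = topspace Z \<longrightarrow>
       (\<exists>\<V>. finite \<V> \<and> (\<forall>V\<in>\<V>. openin Z V) \<and> \<Union>\<V> = topspace Z \<and>
            (\<forall>V\<in>\<V>. \<exists>U\<in>\<U>. V \<subseteq> U) \<and>
            (\<forall>z\<in>topspace Z. int (card {V\<in>\<V>. z \<in> V}) \<le> n + 1)))"

text \<open>The value is \<open>-1\<close> for the empty space and \<open>\<infinity>\<close> if no bound exists.\<close>

definition covering_dim :: "'z topology \<Rightarrow> ereal" where
  "covering_dim Z = (INF n\<in>{n. -1 \<le> n \<and> covering_dim_le Z n}. ereal (real_of_int n))"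

text \<open>The supremum is taken in \<^typ>\<open>ennreal\<close>, so that the empty set has diameter \<open>0\<close>.\<close>

definition diam :: "('y \<Rightarrow> 'y \<Rightarrow> real) \<Rightarrow> 'y set \<Rightarrow> ennreal" where
  "diam \<rho> A = (SUP (x, y)\<in>A \<times> A. ennreal (\<rho> x y))"

definition eps_injective ::
  "'y topology \<Rightarrow> ('y \<Rightarrow> 'y \<Rightarrow> real) \<Rightarrow> real \<Rightarrow> 'z topology \<Rightarrow> ('y \<Rightarrow> 'z) \<Rightarrow> bool" where
  "eps_injective Y \<rho> \<epsilon> Z f \<longleftrightarrow>
     (\<forall>z\<in>topspace Z. diam \<rho> {y \<in> topspace Y. f y = z} < ennreal \<epsilon>)"

text \<open>A compact metric space is represented by its topology \<open>Y\<close> together with a metric \<open>\<rho>\<close>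
  inducing \<open>Y\<close>. Every compact metrizable space embeds into the Hilbert cube, hence is homeomorphic
  to a topology on a subset of \<^typ>\<open>nat \<Rightarrow> real\<close> (\<open>Z\<close> need not carry the product topology); so
  letting \<open>Z\<close> range over topologies on that type accounts for all compact metrizable spaces.\<close>

definition eps_dim :: "'y topology \<Rightarrow> ('y \<Rightarrow> 'y \<Rightarrow> real) \<Rightarrow> real \<Rightarrow> ereal" where
  "eps_dim Y \<rho> \<epsilon> =
     (INF Z\<in>{Z :: (nat \<Rightarrow> real) topology. compact_space Z \<and> metrizable_space Z \<and>
              (\<exists>f. continuous_map Y Z f \<and> eps_injective Y \<rho> \<epsilon> Z f)}. covering_dim Z)"

text \<open>The limit exists by subadditivity when \<open>S\<close> is continuous.\<close>

definition mdim_eps ::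
  "'y topology \<Rightarrow> ('y \<Rightarrow> 'y \<Rightarrow> real) \<Rightarrow> ('y \<Rightarrow> 'y) \<Rightarrow> real \<Rightarrow> ereal" where
  "mdim_eps Y \<rho> S \<epsilon> = lim (\<lambda>n. ereal (1 / real n) * eps_dim Y (dyn_metric S \<rho> n) \<epsilon>)"

section \<open>The space of Borel probability measures\<close>

definition borel_probs :: "'a::topological_space measure set" where
  "borel_probs = {\<mu>. prob_space \<mu> \<and> sets \<mu> = sets borel}"

text \<open>The initial topology for the maps \<open>\<mu> \<mapsto> \<integral> f d\<mu>\<close> with \<open>f\<close> continuous; intended for compact
  spaces, where every such \<open>f\<close> is bounded.\<close>

definition weak_star :: "'a::topological_space measure topology" where
  "weak_star =
     pullback_topology borel_probs
       (\<lambda>\<mu>. \<lambda>f\<in>{f. continuous_on UNIV f}. \<integral>x. f x \<partial>\<mu>)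
       (product_topology (\<lambda>_. euclideanreal) {f :: 'a \<Rightarrow> real. continuous_on UNIV f})"

definition couplings ::
  "'a::topological_space measure \<Rightarrow> 'a measure \<Rightarrow> ('a \<times> 'a) measure set" where
  "couplings \<mu> \<nu> = {\<gamma> \<in> borel_probs. distr \<gamma> borel fst = \<mu> \<and> distr \<gamma> borel snd = \<nu>}"

definition W1 :: "'a::metric_space measure \<Rightarrow> 'a measure \<Rightarrow> real" where
  "W1 \<mu> \<nu> = (INF \<gamma>\<in>couplings \<mu> \<nu>. \<integral>(x, y). dist x y \<partial>\<gamma>)"

definition push_forward :: "('a::topological_space \<Rightarrow> 'a) \<Rightarrow> 'a measure \<Rightarrow> 'a measure" where
  "push_forward T \<mu> = distr \<mu> borel T"

end

theory Submission
  imports Defs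
begin

text \<open>Positive entropy yields, for infinitely many \<open>n\<close>, a set \<open>W\<close> of at least \<open>c n\<close> times below \<open>n\<close> at
  which orbits can be prescribed freely to be close to, or far from, some point (a Sauer-Shelah type
  argument for partial functions). Cut the time interval into blocks of length \<open>m\<close>. A positive
  proportion of the blocks meets \<open>W\<close> in at least \<open>q \<approx> c m / 2\<close> times, so there the orbit realises
  \<open>2\<^sup>q\<close> words independently of the other blocks. Choosing the words of the blocks at random and
  independently, with arbitrary laws, gives a cube of dimension about \<open>(2\<^sup>q - 1) c n / (4 m)\<close> in the
  space of measures. Words that differ in a block come from points at distance at least \<open>r / L\<^sup>m\<close> at
  the start of the block, so opposite faces of the cube are \<open>r / (L\<^sup>m 2\<^sup>q)\<close> apart in the dynamical
  Wasserstein metric, and Lebesgue's covering theorem bounds the dimension at that scale from below.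
  It remains to take \<open>m\<close> of the order of \<open>ln (1 / \<epsilon>)\<close>. Since \<^const>\<open>lim\<close> is meaningless for a divergent
  sequence, the limit defining the mean dimension has to be shown to exist, which rests on the
  product inequality for the covering dimension.\<close>

section \<open>Shattered sets of partial Boolean functions\<close>

text \<open>Two exponentials in \<open>m\<close> are traded against each other. A full block carries
  \<open>2 ^ q\<close> words, hence \<open>2 ^ q - 1\<close> coordinates, while the resolution that
  sees them is of order \<open>1 / (L ^ m * 2 ^ q)\<close>. The Lipschitz condition keeps this price
  exponential: two words of a block may be told apart at any of its times, but a coordinate of the
  cube has to be visible to \<open>W1\<close> at one time common to all words, so every separation
  is moved back to the start of the block. Eliminating \<open>m\<close> gives the exponent \<alpha>
  = c ln 2 / (4 ln (2 L)), with c the density of \<open>W\<close> cut off at 1 and L at least 1; the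
  factor \<open>1 / m\<close> in the number of blocks costs half of the exponent.

  The codes of orbits are partial because "close" and "far" must leave a gap: otherwise different
  letters would not force a positive distance. Hence codes cannot be counted as in the classical
  lemma for total functions; total words completing them are counted instead. A separated set
  injects into families of completions, one for each centre of a finite net, so exponentially many
  separated points rule out having few completions for every centre.\<close>

definition shatters :: "('i \<Rightarrow> bool option) set \<Rightarrow> 'i set \<Rightarrow> bool" where
  "shatters S W \<longleftrightarrow> (\<forall>V\<subseteq>W. \<exists>\<sigma>\<in>S. \<forall>w\<in>W. \<sigma> w = Some (w \<in> V))"

text \<open>One total word may complete many codes. All that is used later is that codes with a
  common completion never take opposite defined values on \<open>Z\<close>.\<close>

definition completes :: "'i set \<Rightarrow> ('i \<Rightarrow> bool) \<Rightarrow> ('i \<Rightarrow> bool option) \<Rightarrow> bool" where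
  "completes Z j \<sigma> \<longleftrightarrow> (\<forall>z\<in>Z. \<forall>b. \<sigma> z = Some b \<longrightarrow> j z = b)"

lemma shatters_mono: "shatters S W \<Longrightarrow> S \<subseteq> S' \<Longrightarrow> shatters S' W"
  unfolding shatters_def by blast

lemma shatters_empty_iff: "shatters S {} \<longleftrightarrow> S \<noteq> {}"
  unfolding shatters_def by auto

lemma shatters_insert:
  assumes "z \<notin> W" "\<And>b. shatters {\<sigma>\<in>S. \<sigma> z = Some b} W"
  shows "shatters S (insert z W)"
  unfolding shatters_def
proof (intro allI impI)
  fix V assume V: "V \<subseteq> insert z W"
  obtain \<sigma> where "\<sigma>\<in>S" "\<sigma> z = Some (z \<in> V)" "\<forall>w\<in>W. \<sigma> w = Some (w \<in> V \<inter> W)"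
    using assms(2)[of "z \<in> V"] unfolding shatters_def
    by (metis (mono_tags, lifting) inf.cobounded2 mem_Collect_eq)
  then show "\<exists>\<sigma>\<in>S. \<forall>w\<in>insert z W. \<sigma> w = Some (w \<in> V)"
    using V by auto
qed

text \<open>Inclusion-exclusion: a set shattered by either half is shattered by \<open>S\<close> and
  avoids \<open>z\<close>, and a set shattered by both halves stays shattered after adding
  \<open>z\<close>, so it is counted twice on the right as well.\<close>

lemma card_shattered_insert:
  fixes S :: "('i \<Rightarrow> bool option) set"
  assumes "finite Z" "z \<notin> Z"
  defines "Sb \<equiv> \<lambda>b. {\<sigma>\<in>S. \<sigma> z = Some b}"
  shows "card {W. W \<subseteq> Z \<and> shatters (Sb True) W} + card {W. W \<subseteq> Z \<and> shatters (Sb False) W}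
     \<le> card {W. W \<subseteq> insert z Z \<and> shatters S W}"
proof -
  let ?A = "{W. W \<subseteq> Z \<and> shatters (Sb True) W}" and ?B = "{W. W \<subseteq> Z \<and> shatters (Sb False) W}"
  let ?C = "{W. W \<subseteq> insert z Z \<and> shatters S W}"
  have fin: "finite ?A" "finite ?B" "finite ?C" "finite (insert z ` (?A \<inter> ?B))"
    using assms(1) by (auto intro: finite_subset[of _ "Pow (insert z Z)"])
  have "card ?A + card ?B = card (?A \<union> ?B) + card (?A \<inter> ?B)"
    using card_Un_Int[OF fin(1,2)] .
  also have "card (?A \<inter> ?B) = card (insert z ` (?A \<inter> ?B))"
    by (rule card_image[symmetric]) (use assms(2) in \<open>auto simp: inj_on_def\<close>)
  also have "card (?A \<union> ?B) + card (insert z ` (?A \<inter> ?B)) = card ((?A \<union> ?B) \<union> insert z ` (?A \<inter> ?B))"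
    by (rule card_Un_disjoint[symmetric]) (use fin assms(2) in auto)
  also have "\<dots> \<le> card ?C"
  proof (rule card_mono[OF fin(3)])
    have "shatters S W" if "shatters (Sb b) W" for b W
      using that unfolding Sb_def by (rule shatters_mono) auto
    moreover have "shatters S (insert z W)" if "W \<in> ?A \<inter> ?B" for W
    proof (rule shatters_insert)
      show "z \<notin> W" using that assms(2) by auto
      show "shatters {\<sigma>\<in>S. \<sigma> z = Some b} W" for b
        using that unfolding Sb_def by (cases b) auto
    qed
    ultimately show "(?A \<union> ?B) \<union> insert z ` (?A \<inter> ?B) \<subseteq> ?C" by blast
  qed
  finally show ?thesis .
qed

text \<open>The halving strategy: read the coordinates one after another and predict, at each of them, the
  value whose subfamily shatters more sets. A wrong prediction halves the number of shattered sets,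
  so a member of \<open>S\<close> is described, up to undefined values, by its fewer than \<open>k\<close> mistakes.\<close>

lemma completions_if_few_shattered:
  assumes "finite Z" "card {W. W \<subseteq> Z \<and> shatters S W} < 2 ^ k"
  shows "\<exists>J. finite J \<and> card J \<le> (\<Sum>i<k. card Z choose i) \<and> (\<forall>\<sigma>\<in>S. \<exists>j\<in>J. completes Z j \<sigma>)"
  using assms
proof (induction Z arbitrary: S k rule: finite_induct)
  case empty
  show ?case
  proof (cases "S = {}")
    case False
    have "{W. W \<subseteq> {} \<and> shatters S W} = {{}}" using False shatters_empty_iff[of S] by auto
    then have "k > 0" using empty by (cases k) auto
    then have "1 \<le> (\<Sum>i<k. (0::nat) choose i)"
      using member_le_sum[of 0 "{..<k}" "\<lambda>i. (0::nat) choose i"] by auto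
    then show ?thesis by (intro exI[of _ "{\<lambda>_. True}"]) (auto simp: completes_def)
  qed (auto intro!: exI[of _ "{}"])
next
  case (insert z Z)
  define N where "N = (\<lambda>S. card {W. W \<subseteq> Z \<and> shatters S W})"
  define Sb where "Sb = (\<lambda>b. {\<sigma>\<in>S. \<sigma> z = Some b})"
  have fin: "finite {W. W \<subseteq> insert z Z \<and> shatters S W}"
    using insert by (auto intro: finite_subset[of _ "Pow (insert z Z)"])
  show ?case
  proof (cases k)
    case 0
    then have "\<not> shatters S {}" using insert.prems fin by auto
    then have "S = {}" by (simp add: shatters_empty_iff)
    then show ?thesis by (intro exI[of _ "{}"]) auto
  next
    case (Suc k')
    have sum: "N (Sb True) + N (Sb False) < 2 * 2 ^ k'"
      using card_shattered_insert[OF insert.hyps, of S] insert.prems unfolding N_def Sb_def Suc by simp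
    \<comment> \<open>One of the two halves shatters fewer than \<open>2 ^ k'\<close> sets. Its
      value \<open>b\<close> is the one not predicted: a code with value \<open>b\<close> at
      \<open>z\<close> has made a mistake and goes on with the smaller budget
      \<open>k'\<close>.\<close>
    then obtain b where b: "N (Sb b) < 2 ^ k'"
      by (metis add_mono mult_2 not_le)
    then obtain J1 where J1: "finite J1" "card J1 \<le> (\<Sum>i<k'. card Z choose i)"
      "\<forall>\<sigma>\<in>Sb b. \<exists>j\<in>J1. completes Z j \<sigma>"
      using insert.IH[of "Sb b" k'] unfolding N_def by blast
    \<comment> \<open>The budget \<open>k\<close> is kept for all of \<open>S\<close> and not only
      for the codes with value \<open>\<not> b\<close>, because codes undefined at \<open>z\<close>
      follow the prediction too.\<close>
    have "N S \<le> card {W. W \<subseteq> insert z Z \<and> shatters S W}"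
      unfolding N_def by (rule card_mono[OF fin]) auto
    then have "N S < 2 ^ k" using insert.prems by simp
    then obtain J0 where J0: "finite J0" "card J0 \<le> (\<Sum>i<k. card Z choose i)"
      "\<forall>\<sigma>\<in>S. \<exists>j\<in>J0. completes Z j \<sigma>"
      using insert.IH[of S k] unfolding N_def by blast
    define J where "J = (\<lambda>j. j(z := \<not> b)) ` J0 \<union> (\<lambda>j. j(z := b)) ` J1"
    have "card J \<le> card ((\<lambda>j. j(z := \<not> b)) ` J0) + card ((\<lambda>j. j(z := b)) ` J1)"
      unfolding J_def by (rule card_Un_le)
    also have "\<dots> \<le> card J0 + card J1"
      by (intro add_mono card_image_le J0 J1)
    also have "\<dots> \<le> (\<Sum>i<Suc k'. card Z choose i) + (\<Sum>i<k'. card Z choose i)"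
      using J0 J1 Suc by simp
    also have "\<dots> = (\<Sum>i<k. card (insert z Z) choose i)"
      using insert.hyps Suc by (simp add: sum.lessThan_Suc_shift sum.distrib del: sum.lessThan_Suc)
    finally have card: "card J \<le> (\<Sum>i<k. card (insert z Z) choose i)" .
    have upd: "completes (insert z Z) (j(z := c)) \<sigma>"
      if "completes Z j \<sigma>" "\<sigma> z = None \<or> \<sigma> z = Some c" for j \<sigma> c
      using that insert.hyps unfolding completes_def by auto
    have "\<exists>j\<in>J. completes (insert z Z) j \<sigma>" if \<sigma>: "\<sigma> \<in> S" for \<sigma>
    proof (cases "\<sigma> z = Some b")
      case True
      then obtain j where "j \<in> J1" "completes Z j \<sigma>" using J1 \<sigma> unfolding Sb_def by auto
      then show ?thesis using upd True unfolding J_def by blast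
    next
      case False
      then have *: "\<sigma> z = None \<or> \<sigma> z = Some (\<not> b)" by (cases "\<sigma> z") auto
      obtain j where "j \<in> J0" "completes Z j \<sigma>" using J0 \<sigma> by auto
      then have "completes (insert z Z) (j(z := \<not> b)) \<sigma>" by (intro upd *)
      then show ?thesis using \<open>j \<in> J0\<close> unfolding J_def by blast
    qed
    then show ?thesis using card J0 J1 unfolding J_def by (intro exI[of _ J]) (auto simp: J_def)
  qed
qed

lemma card_small_subsets:
  assumes "finite Z"
  shows "card {W. W \<subseteq> Z \<and> card W < k} = (\<Sum>i<k. card Z choose i)"
proof -
  have "{W. W \<subseteq> Z \<and> card W < k} = (\<Union>i<k. {W. W \<subseteq> Z \<and> card W = i})" by auto
  also have "card \<dots> = (\<Sum>i<k. card {W. W \<subseteq> Z \<and> card W = i})"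
    by (rule card_UN_disjoint) (use assms in \<open>auto intro: finite_subset[of _ "Pow Z"]\<close>)
  finally show ?thesis using n_subsets[OF assms] by simp
qed

text \<open>Chernoff's trick: since \<open>x \<le> 1\<close>, weighting by
  \<open>x ^ k \<le> x ^ i\<close> bounds the tail by \<open>(x + 1) ^ n / x ^ k\<close>. The
  numerator costs \<open>exp (x * n)\<close>, the denominator \<open>exp (k * l)\<close> with
  \<open>l = ln (1 / x)\<close>; each gets half of the exponent \<open>b * n\<close>.\<close>

lemma binomial_tail_exp_bound:
  fixes b :: real
  assumes "b > 0"
  shows "\<exists>c>0. \<forall>n k. real k \<le> c * real n \<longrightarrow> real (\<Sum>i<k. n choose i) \<le> exp (b * real n)"
proof -
  define x where "x = min 1 (b / 2)"
  have x: "0 < x" "x \<le> 1" "x \<le> b / 2" using assms by (auto simp: x_def)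
  define l where "l = ln (1 / x)"
  have l: "l \<ge> 0" using x by (simp add: l_def)
  \<comment> \<open>Dividing by \<open>l + 1\<close> instead of \<open>l\<close> covers the case
    \<open>x = 1\<close>, where \<open>l = 0\<close>.\<close>
  define c where "c = b / 2 / (l + 1)"
  have c: "c > 0" using assms l by (simp add: c_def)
  have cl: "c * l \<le> b / 2"
    using assms l by (simp add: c_def field_simps)
  have "real (\<Sum>i<k. n choose i) \<le> exp (b * real n)" if "real k \<le> c * real n" for n k
  proof -
    have "x ^ k * real (\<Sum>i<k. n choose i) = (\<Sum>i<k. real (n choose i) * x ^ k)"
      by (simp add: sum_distrib_left mult.commute)
    also have "\<dots> \<le> (\<Sum>i<k. real (n choose i) * x ^ i)"
      by (intro sum_mono mult_left_mono power_decreasing) (use x in auto)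
    also have "\<dots> = (\<Sum>i\<in>{..<k} \<inter> {..n}. real (n choose i) * x ^ i)"
      by (rule sum.mono_neutral_right) auto
    also have "\<dots> \<le> (\<Sum>i\<le>n. real (n choose i) * x ^ i)"
      by (rule sum_mono2) (use x in auto)
    also have "\<dots> = (x + 1) ^ n"
      using binomial_ring[of x 1 n] by simp
    also have "\<dots> \<le> exp x ^ n"
      by (intro power_mono) (use x exp_ge_add_one_self[of x] in \<open>auto simp: add.commute\<close>)
    also have "\<dots> = exp (x * real n)"
      by (simp add: exp_of_nat_mult[symmetric] mult.commute)
    finally have "x ^ k * real (\<Sum>i<k. n choose i) \<le> exp (x * real n)" .
    then have "real (\<Sum>i<k. n choose i) \<le> exp (x * real n) / x ^ k"
      using x by (simp add: field_simps)
    also have "\<dots> = exp (x * real n + real k * l)"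
    proof -
      have "exp (real k * l) = 1 / x ^ k"
        using x by (simp add: l_def exp_of_nat_mult power_one_over)
      then show ?thesis by (simp add: exp_add)
    qed
    also have "\<dots> \<le> exp (b * real n)"
    proof -
      have "real k * l \<le> c * real n * l" using that l by (rule mult_right_mono)
      also have "\<dots> = c * l * real n" by simp
      also have "\<dots> \<le> b / 2 * real n" by (intro mult_right_mono cl) auto
      finally have "real k * l \<le> b / 2 * real n" .
      moreover have "x * real n \<le> b / 2 * real n" by (intro mult_right_mono x) auto
      ultimately show ?thesis by simp
    qed
    finally show ?thesis .
  qed
  then show ?thesis using c by blast
qed

text \<open>The tail bound is used twice. It first bounds the number of small sets, hence of
  shattered sets, by \<open>2 ^ k\<close> with \<open>k\<close> a small multiple of the size of
  \<open>Z\<close>; then it bounds the number of completions, which is the number of ways to place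
  fewer than \<open>k\<close> mistakes.\<close>

lemma completions_if_small_shattered:
  fixes b :: real
  assumes "b > 0"
  shows "\<exists>c>0. \<exists>n0. \<forall>Z :: 'i set. \<forall>S. finite Z \<and> n0 \<le> card Z \<and>
      (\<forall>W\<subseteq>Z. shatters S W \<longrightarrow> real (card W) \<le> c * real (card Z)) \<longrightarrow>
      (\<exists>J. finite J \<and> real (card J) \<le> exp (b * real (card Z)) \<and> (\<forall>\<sigma>\<in>S. \<exists>j\<in>J. completes Z j \<sigma>))"
proof -
  obtain c2 where c2: "c2 > 0" "\<And>n k. real k \<le> c2 * real n \<Longrightarrow> real (\<Sum>i<k. n choose i) \<le> exp (b * real n)"
    using binomial_tail_exp_bound[OF assms] by blast
  define b1 where "b1 = c2 * ln 2 / 2"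
  have "b1 > 0" using c2 by (simp add: b1_def)
  then obtain c1 where c1: "c1 > 0" "\<And>n k. real k \<le> c1 * real n \<Longrightarrow> real (\<Sum>i<k. n choose i) \<le> exp (b1 * real n)"
    using binomial_tail_exp_bound by blast
  \<comment> \<open>From \<open>n0\<close> on both \<open>c1 * n\<close> and \<open>c2 * n\<close>
    are at least 2, which pays for the \<open>+ 1\<close> in the definitions of \<open>d\<close> and
    \<open>k\<close>.\<close>
  define n0 where "n0 = nat \<lceil>max (2 / c1) (2 / c2)\<rceil>"
  have *: "\<exists>J. finite J \<and> real (card J) \<le> exp (b * real (card Z)) \<and> (\<forall>\<sigma>\<in>S. \<exists>j\<in>J. completes Z j \<sigma>)"
    if Z: "finite Z" "n0 \<le> card Z"
      and sh: "\<And>W. W \<subseteq> Z \<Longrightarrow> shatters S W \<Longrightarrow> real (card W) \<le> c1 / 2 * real (card Z)"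
    for Z :: "'i set" and S
  proof -
    define n where "n = card Z"
    have "real n \<ge> max (2 / c1) (2 / c2)" using Z unfolding n0_def n_def by linarith
    then have n: "c1 * real n \<ge> 2" "c2 * real n \<ge> 2" using c1 c2 by (auto simp: field_simps)
    define d where "d = nat \<lfloor>c1 / 2 * real n\<rfloor> + 1"
    have d1: "real d \<le> c1 * real n" using n c1 unfolding d_def
      by (simp add: algebra_simps) linarith
    define k where "k = nat \<lfloor>b1 * real n / ln 2\<rfloor> + 1"
    have k1: "b1 * real n / ln 2 < real k" unfolding k_def by (simp) linarith
    have "b1 * real n / ln 2 = c2 * real n / 2" by (simp add: b1_def)
    then have k2: "real k \<le> c2 * real n" using n c2 unfolding k_def
      by (simp add: algebra_simps) linarith
    have "{W. W \<subseteq> Z \<and> shatters S W} \<subseteq> {W. W \<subseteq> Z \<and> card W < d}"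
      using sh unfolding d_def n_def by (auto simp: le_nat_floor less_Suc_eq_le)
    then have "card {W. W \<subseteq> Z \<and> shatters S W} \<le> card {W. W \<subseteq> Z \<and> card W < d}"
      by (rule card_mono[rotated]) (use Z in \<open>auto intro: finite_subset[of _ "Pow Z"]\<close>)
    then have "real (card {W. W \<subseteq> Z \<and> shatters S W}) \<le> real (\<Sum>i<d. n choose i)"
      using card_small_subsets[OF Z(1)] unfolding n_def by (metis of_nat_mono)
    also have "\<dots> \<le> exp (b1 * real n)" by (rule c1(2)[OF d1])
    also have "\<dots> < exp (real k * ln 2)" using k1 by (simp add: field_simps)
    also have "\<dots> = 2 ^ k" by (simp add: exp_of_nat_mult)
    finally have "card {W. W \<subseteq> Z \<and> shatters S W} < 2 ^ k"
      by (metis of_nat_less_iff of_nat_numeral of_nat_power)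
    from completions_if_few_shattered[OF Z(1) this] obtain J where
      "finite J" "card J \<le> (\<Sum>i<k. n choose i)" "\<forall>\<sigma>\<in>S. \<exists>j\<in>J. completes Z j \<sigma>"
      unfolding n_def by blast
    moreover have "real (\<Sum>i<k. n choose i) \<le> exp (b * real n)" by (rule c2(2)[OF k2])
    ultimately show ?thesis unfolding n_def by (meson of_nat_mono order_trans)
  qed
  show ?thesis
    by (rule exI[of _ "c1 / 2"], intro conjI exI[of _ n0] allI impI)
       (use c1 in simp, rule *, auto)
qed

section \<open>Positive entropy and free words\<close>

lemma dyn_metric_ge:
  assumes "i < n"
  shows "\<rho> ((S ^^ i) x) ((S ^^ i) y) \<le> dyn_metric S \<rho> n x y"
  unfolding dyn_metric_def using assms by (intro Max_ge) auto

lemma dyn_metric_le_iff: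
  assumes "0 < n"
  shows "dyn_metric S \<rho> n x y \<le> c \<longleftrightarrow> (\<forall>i<n. \<rho> ((S ^^ i) x) ((S ^^ i) y) \<le> c)"
  unfolding dyn_metric_def using assms by (subst Max_le_iff) auto

lemma positive_entropy_separated:
  fixes T :: "'a::metric_space \<Rightarrow> 'a"
  assumes "topological_entropy T > 0"
  shows "\<exists>\<delta>>0. \<exists>h>0. \<exists>\<^sub>F n in sequentially.
           \<exists>E. finite E \<and> separated T n \<delta> E \<and> exp (h * real n) < real (card E)"
proof -
  define s where "s = (\<lambda>\<delta> n. SUP E\<in>{E. finite E \<and> separated T n \<delta> E}. ereal (ln (real (card E))))"
  obtain \<delta> where \<delta>: "\<delta> > 0" "limsup (\<lambda>n. ereal (1 / real n) * s \<delta> n) > 0"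
    using assms unfolding topological_entropy_def s_def less_SUP_iff by auto
  obtain h where h: "ereal h > 0" "limsup (\<lambda>n. ereal (1 / real n) * s \<delta> n) > ereal h"
    using ereal_dense2[OF \<delta>(2)] by blast
  have "\<exists>\<^sub>F n in sequentially. ereal (1 / real n) * s \<delta> n > ereal h"
  proof (rule ccontr)
    assume "\<not> ?thesis"
    then have "\<forall>\<^sub>F n in sequentially. ereal (1 / real n) * s \<delta> n \<le> ereal h"
      by (simp add: not_frequently not_less)
    then have "limsup (\<lambda>n. ereal (1 / real n) * s \<delta> n) \<le> ereal h" by (rule Limsup_bounded)
    then show False using h(2) by simp
  qed
  moreover have "\<exists>E. finite E \<and> separated T n \<delta> E \<and> exp (h * real n) < real (card E)"
    if n: "ereal (1 / real n) * s \<delta> n > ereal h" for n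
  proof -
    \<comment> \<open>At \<open>n = 0\<close> the factor \<open>1 / real n\<close> is
      \<open>0\<close>, so the product cannot exceed the positive \<open>h\<close>.\<close>
    have "n > 0" using n h by (cases n) (auto simp: zero_ereal_def[symmetric])
    then have "s \<delta> n > ereal (h * real n)"
      using n by (cases "s \<delta> n") (auto simp: field_simps split: if_splits)
    then obtain E where E: "finite E" "separated T n \<delta> E" "ln (real (card E)) > h * real n"
      unfolding s_def less_SUP_iff by auto
    have "h * real n > 0" using h \<open>n > 0\<close> by simp
    then have "card E > 0" using E by (cases "card E") auto
    then have "exp (h * real n) < real (card E)"
      using E(3) by (metis exp_less_mono exp_ln of_nat_0_less_iff)
    then show ?thesis using E by blast
  qed
  ultimately have "\<exists>\<^sub>F n in sequentially. \<exists>E. finite E \<and> separated T n \<delta> E \<and> exp (h * real n) < real (card E)"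
    by (rule frequently_elim1)
  then show ?thesis using \<delta>(1) h(1) by auto
qed

text \<open>Points in the annulus between the radii \<open>r\<close> and \<open>2 * r\<close> get no
  letter. Thus opposite letters at a time force distance at least \<open>r\<close> at that
  time.\<close>

definition ball_code :: "('a::metric_space \<Rightarrow> 'a) \<Rightarrow> real \<Rightarrow> 'a \<Rightarrow> 'a \<Rightarrow> nat \<Rightarrow> bool option" where
  "ball_code T r y x i =
     (if dist ((T ^^ i) x) y \<le> r then Some False
      else if dist ((T ^^ i) x) y \<ge> 2 * r then Some True else None)"

text \<open>Suppose that for some large good \<open>n\<close> no centre admits a large shattered
  set. Then the codes around each point of a finite \<open>r\<close>-net \<open>Y\<close> have few
  completions, and a separated set injects into the product of these completion sets over
  \<open>Y\<close>, which is too small. The centre \<open>y\<close> may vary with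
  \<open>n\<close>.\<close>

lemma positive_entropy_shatters:
  fixes T :: "'a::metric_space \<Rightarrow> 'a"
  assumes compact: "compact (UNIV :: 'a set)" and ent: "topological_entropy T > 0"
  shows "\<exists>r>0. \<exists>c>0. \<exists>\<^sub>F n in sequentially.
           \<exists>y W. W \<subseteq> {..<n} \<and> c * real n < real (card W) \<and> shatters (range (ball_code T r y)) W"
proof -
  obtain \<delta> h where \<delta>: "\<delta> > 0" and h: "h > 0"
    and freq: "\<exists>\<^sub>F n in sequentially.
           \<exists>E. finite E \<and> separated T n \<delta> E \<and> exp (h * real n) < real (card E)"
    using positive_entropy_separated[OF ent] by blast
  \<comment> \<open>If two points are more than \<delta> apart and a centre is within
    \<open>r\<close> of one, it is more than \<open>3 * r\<close> away from the other, so the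
    letters there are opposite.\<close>
  define r where "r = \<delta> / 4"
  have r: "r > 0" using \<delta> by (simp add: r_def)
  obtain Y where Y: "finite Y" "(UNIV :: 'a set) \<subseteq> (\<Union>y\<in>Y. ball y r)"
  proof -
    have "seq_compact (UNIV :: 'a set)" using compact by (simp add: compact_imp_seq_compact)
    from seq_compact_imp_totally_bounded[OF this, rule_format, OF r] show ?thesis using that by blast
  qed
  have "Y \<noteq> {}" using Y(2) by (metis UN_empty UNIV_I empty_iff subset_eq)
  then have Y0: "card Y > 0" using Y(1) by (simp add: card_gt_0_iff)
  \<comment> \<open>With this rate the product over \<open>Y\<close> of \<open>exp (b * n)\<close>
    is exactly \<open>exp (h * n)\<close>.\<close>
  define b where "b = h / real (card Y)"
  have b: "b > 0" using h Y0 by (simp add: b_def)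
  obtain c n0 where c: "c > 0" and compl: "\<forall>Z :: nat set. \<forall>S. finite Z \<and> n0 \<le> card Z \<and>
      (\<forall>W\<subseteq>Z. shatters S W \<longrightarrow> real (card W) \<le> c * real (card Z)) \<longrightarrow>
      (\<exists>J. finite J \<and> real (card J) \<le> exp (b * real (card Z)) \<and> (\<forall>\<sigma>\<in>S. \<exists>j\<in>J. completes Z j \<sigma>))"
    using completions_if_small_shattered[OF b, where 'i = nat] by (elim exE conjE) (rule that, assumption+)
  have "\<exists>y W. W \<subseteq> {..<n} \<and> c * real n < real (card W) \<and> shatters (range (ball_code T r y)) W"
    if n: "n \<ge> Suc n0" and E: "finite E" "separated T n \<delta> E" "exp (h * real n) < real (card E)" for n E
  proof (rule ccontr)
    assume no: "\<not> ?thesis"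
    have ex: "\<exists>J. finite J \<and> real (card J) \<le> exp (b * real n) \<and>
        (\<forall>\<sigma>\<in>range (ball_code T r y). \<exists>j\<in>J. completes {..<n} j \<sigma>)" for y
    proof -
      have "\<forall>W\<subseteq>{..<n}. shatters (range (ball_code T r y)) W \<longrightarrow> real (card W) \<le> c * real (card {..<n})"
        using no by (auto simp: not_less)
      with compl[rule_format, of "{..<n}" "range (ball_code T r y)"] n show ?thesis by simp
    qed
    obtain J where J: "\<And>y. finite (J y)" "\<And>y. real (card (J y)) \<le> exp (b * real n)"
      "\<And>y x. \<exists>j\<in>J y. completes {..<n} j (ball_code T r y x)"
    proof -
      have "\<exists>J. \<forall>y. finite (J y) \<and> real (card (J y)) \<le> exp (b * real n) \<and>
          (\<forall>\<sigma>\<in>range (ball_code T r y). \<exists>j\<in>J y. completes {..<n} j \<sigma>)"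
        by (intro choice allI ex)
      then show ?thesis using that by blast
    qed
    obtain j where j: "\<And>y x. j y x \<in> J y" "\<And>y x. completes {..<n} (j y x) (ball_code T r y x)"
    proof -
      have "\<forall>y x. \<exists>j. j \<in> J y \<and> completes {..<n} j (ball_code T r y x)" using J(3) by blast
      then have "\<exists>j. \<forall>y x. j y x \<in> J y \<and> completes {..<n} (j y x) (ball_code T r y x)"
        by (intro choice allI) blast
      then show ?thesis using that by blast
    qed
    have "inj_on (\<lambda>x. \<lambda>y\<in>Y. j y x) E"
    proof (rule inj_onI, rule ccontr)
      fix x x' assume xx': "x \<in> E" "x' \<in> E" "(\<lambda>y\<in>Y. j y x) = (\<lambda>y\<in>Y. j y x')" "x \<noteq> x'"
      then have dm: "dyn_metric T dist n x x' > \<delta>" using E(2) unfolding separated_def by auto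
      have "n > 0" using n by simp
      then obtain i where i: "i < n" "dist ((T ^^ i) x) ((T ^^ i) x') > \<delta>"
        using dm dyn_metric_le_iff[of n T dist x x' \<delta>] by (auto simp: not_le)
      obtain y where y: "y \<in> Y" "dist y ((T ^^ i) x) < r"
        using subsetD[OF Y(2) UNIV_I[of "(T ^^ i) x"]] by auto
      have "\<delta> < dist y ((T ^^ i) x) + dist y ((T ^^ i) x')"
        using i(2) dist_triangle3[of "(T ^^ i) x" "(T ^^ i) x'" y] by linarith
      then have far: "dist ((T ^^ i) x') y > 2 * r" using y(2) r r_def by (simp add: dist_commute)
      then have "ball_code T r y x i = Some False" "ball_code T r y x' i = Some True"
        using y r by (auto simp: ball_code_def dist_commute)
      then have "\<not> j y x i" "j y x' i" using j(2) i(1) unfolding completes_def by blast+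
      moreover have "j y x = j y x'" using fun_cong[OF xx'(3), of y] y(1) by simp
      ultimately show False by simp
    qed
    then have "card E \<le> card (PiE Y J)"
      by (rule card_inj_on_le) (use j Y J in \<open>auto intro!: finite_PiE\<close>)
    also have "\<dots> = (\<Prod>y\<in>Y. card (J y))" using Y(1) by (rule card_PiE)
    finally have "real (card E) \<le> (\<Prod>y\<in>Y. real (card (J y)))" by (metis of_nat_mono of_nat_prod)
    also have "\<dots> \<le> (\<Prod>y\<in>Y. exp (b * real n))" by (intro prod_mono) (use J in auto)
    also have "\<dots> = exp (h * real n)"
      using Y0 by (simp add: exp_of_nat_mult[symmetric] b_def)
    finally show False using E(3) by simp
  qed
  then have "\<forall>\<^sub>F n in sequentially. (\<exists>E. finite E \<and> separated T n \<delta> E \<and> exp (h * real n) < real (card E)) \<longrightarrow>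
      (\<exists>y W. W \<subseteq> {..<n} \<and> c * real n < real (card W) \<and> shatters (range (ball_code T r y)) W)"
    unfolding eventually_sequentially by (intro exI[of _ "Suc n0"] allI impI, elim exE conjE) assumption
  then have "\<exists>\<^sub>F n in sequentially. \<exists>y W. W \<subseteq> {..<n} \<and> c * real n < real (card W) \<and> shatters (range (ball_code T r y)) W"
    using freq by (rule frequently_rev_mp[rotated])
  then show ?thesis using r c by blast
qed

lemma dist_funpow_le:
  fixes T :: "'a::metric_space \<Rightarrow> 'a"
  assumes "L-lipschitz_on UNIV T"
  shows "dist ((T ^^ i) x) ((T ^^ i) y) \<le> L ^ i * dist x y"
proof (induction i)
  case (Suc i)
  have "dist ((T ^^ Suc i) x) ((T ^^ Suc i) y) \<le> L * dist ((T ^^ i) x) ((T ^^ i) y)"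
    using lipschitz_onD[OF assms] by simp
  also have "\<dots> \<le> L * (L ^ i * dist x y)"
    by (rule mult_left_mono[OF Suc lipschitz_on_nonneg[OF assms]])
  finally show ?case by (simp add: mult.assoc)
qed simp

text \<open>Blocks outside \<open>G\<close> contain fewer than \<open>q \<le> c * m / 2\<close>
  elements of \<open>W\<close> each, so together at most \<open>c * n / 2 + c * m / 2\<close>, which
  is at most \<open>3 * c * n / 4\<close> once \<open>n \<ge> 2 * m\<close>. The remaining quarter
  lies in blocks of \<open>G\<close>, each of which holds at most \<open>m\<close> elements.\<close>

lemma full_blocks:
  fixes c :: real and W :: "nat set"
  assumes W: "W \<subseteq> {..<n}" "c * real n < real (card W)"
    and m: "m > 0" "n \<ge> 2 * m" and q: "q > 0" "2 * real q \<le> c * real m"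
  shows "\<exists>G. finite G \<and> c * real n / (4 * real m) \<le> real (card G) \<and>
           (\<forall>k\<in>G. k * m < n \<and> q \<le> card (W \<inter> {k * m..<k * m + m}))"
proof -
  define B where "B = (\<lambda>k. W \<inter> {k * m..<k * m + m})"
  define G where "G = {k \<in> {..n div m}. q \<le> card (B k)}"
  have finW: "finite W" using W by (auto intro: finite_subset)
  have "W \<subseteq> (\<Union>k\<le>n div m. B k)"
  proof
    fix i assume i: "i \<in> W"
    have "i div m \<le> n div m" using i W by (intro div_le_mono) auto
    moreover have "i < i div m * m + m"
      using add_strict_left_mono[OF mod_less_divisor[OF m(1), of i], of "i div m * m"] by simp
    then have "i \<in> B (i div m)" using i unfolding B_def by simp
    ultimately show "i \<in> (\<Union>k\<le>n div m. B k)" by blast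
  qed
  then have "card W \<le> card (\<Union>k\<le>n div m. B k)"
    by (intro card_mono) (use finW in \<open>auto simp: B_def\<close>)
  also have "\<dots> \<le> (\<Sum>k\<le>n div m. card (B k))" by (rule card_UN_le) simp
  also have "\<dots> \<le> (\<Sum>k\<le>n div m. (if k \<in> G then m else 0) + q)"
  proof (rule sum_mono)
    fix k assume k: "k \<in> {..n div m}"
    have "card (B k) \<le> card {k * m..<k * m + m}" unfolding B_def by (intro card_mono) auto
    then show "card (B k) \<le> (if k \<in> G then m else 0) + q" using k unfolding G_def by auto
  qed
  also have "\<dots> = card G * m + (n div m + 1) * q"
    by (simp add: sum.distrib sum.If_cases G_def Int_def)
  finally have "real (card W) \<le> real (card G) * real m + (real (n div m) + 1) * real q"
    by (metis of_nat_mono of_nat_add of_nat_mult of_nat_1)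
  also have "(real (n div m) + 1) * real q \<le> (real n / real m + 1) * (c * real m / 2)"
    by (intro mult_mono add_mono of_nat_div_le_of_nat) (use q in auto)
  also have "\<dots> = c * real n / 2 + c * real m / 2" using m by (simp add: field_simps)
  finally have *: "c * real n / 2 < real (card G) * real m + c * real m / 2" using W(2) by simp
  have "c * real m \<ge> 0" using q by simp
  then have "c \<ge> 0" using m by (simp add: zero_le_mult_iff)
  then have "c * real m \<le> c * (real n / 2)" using m by (intro mult_left_mono) auto
  then have "c * real n / 4 \<le> real (card G) * real m" using * by simp
  then have "c * real n / (4 * real m) \<le> real (card G)" using m by (simp add: field_simps)
  moreover have "k * m < n" if "k \<in> G" for k
  proof -
    have "B k \<noteq> {}" using that q unfolding G_def by auto
    then show ?thesis using W unfolding B_def by fastforce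
  qed
  ultimately show ?thesis by (intro exI[of _ G]) (auto simp: G_def B_def)
qed

text \<open>Each word \<open>s b\<close> encodes a subset of the \<open>b\<close>-th full block of the shattered set.\<close>

lemma free_words:
  fixes T :: "'a::metric_space \<Rightarrow> 'a"
  assumes L: "L-lipschitz_on UNIV T" "L \<ge> 1" and r: "r > 0"
    and W: "W \<subseteq> {..<n}" "c * real n < real (card W)" "shatters (range (ball_code T r y)) W"
    and m: "m > 0" "n \<ge> 2 * m" and q: "q > 0" "2 * real q \<le> c * real m"
  shows "\<exists>M \<beta> x. c * real n / (4 * real m) \<le> real M \<and> (\<forall>b<M. \<beta> b < n) \<and>
     (\<forall>b<M. \<forall>s s' :: nat \<Rightarrow> nat. s b < 2 ^ q \<longrightarrow> s' b < 2 ^ q \<longrightarrow> s b \<noteq> s' b \<longrightarrow>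
        r / L ^ m \<le> dist ((T ^^ \<beta> b) (x s)) ((T ^^ \<beta> b) (x s')))"
proof -
  obtain G where G: "finite G" "c * real n / (4 * real m) \<le> real (card G)"
    "\<And>k. k \<in> G \<Longrightarrow> k * m < n" "\<And>k. k \<in> G \<Longrightarrow> q \<le> card (W \<inter> {k * m..<k * m + m})"
    using full_blocks[OF W(1,2) m q] by blast
  define M where "M = card G"
  obtain e where e: "bij_betw e {0..<M} G" using ex_bij_betw_nat_finite[OF G(1)] M_def by blast
  have eG: "e b \<in> G" if "b < M" for b using bij_betwE[OF e] that by auto
  have "\<exists>J. J \<subseteq> W \<inter> {k * m..<k * m + m} \<and> card J = q \<and> finite J" if "k \<in> G" for k
    using obtain_subset_with_card_n[OF G(4)[OF that]] by metis
  then obtain J where J: "\<And>k. k \<in> G \<Longrightarrow> J k \<subseteq> W \<inter> {k * m..<k * m + m}" "\<And>k. k \<in> G \<Longrightarrow> card (J k) = q"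
    "\<And>k. k \<in> G \<Longrightarrow> finite (J k)"
    by metis
  have "\<exists>f. bij_betw f {..<(2::nat) ^ q} (Pow (J k))" if "k \<in> G" for k
    using J[OF that] by (intro finite_same_card_bij) (auto simp: card_Pow)
  then obtain f where f: "\<And>k. k \<in> G \<Longrightarrow> bij_betw (f k) {..<(2::nat) ^ q} (Pow (J k))" by metis
  define V where "V = (\<lambda>s. (\<Union>b<M. f (e b) (s b)) \<inter> W)"
  have "\<exists>x. \<forall>i\<in>W. ball_code T r y x i = Some (i \<in> V s)" for s
    using W(3) unfolding shatters_def V_def by (metis (no_types, lifting) inf_le2 rangeE)
  then obtain x where x: "\<And>s i. i \<in> W \<Longrightarrow> ball_code T r y (x s) i = Some (i \<in> V s)" by metis
  \<comment> \<open>The blocks are disjoint, so whether a time \<open>i\<close> of one block belongs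
    to \<open>V s\<close> is decided by the letter of that block alone.\<close>
  have block: "i \<in> V s \<longleftrightarrow> i \<in> f (e b) (s b)"
    if b: "b < M" and i: "i \<in> J (e b)" and s: "\<And>b. b < M \<Longrightarrow> s b < 2 ^ q" for b i s
  proof -
    have uniq: "b' = b" if "b' < M" "i \<in> f (e b') (s b')" for b'
    proof -
      have "i \<in> J (e b')" using f[OF eG[OF that(1)]] s[OF that(1)] that(2) by (auto dest!: bij_betwE)
      then have "i \<in> {e b' * m..<e b' * m + m}" "i \<in> {e b * m..<e b * m + m}"
        using J(1)[OF eG[OF that(1)]] J(1)[OF eG[OF b]] i by auto
      then have "e b' = i div m" "e b = i div m"
        by (auto intro!: div_nat_eqI[symmetric] simp: mult.commute[of m])
      then show ?thesis using e that(1) b by (auto simp: bij_betw_def inj_on_def)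
    qed
    have "i \<in> W" using J(1)[OF eG[OF b]] i by auto
    then have "i \<in> V s \<longleftrightarrow> (\<exists>b'<M. i \<in> f (e b') (s b'))" unfolding V_def by auto
    also have "\<dots> \<longleftrightarrow> i \<in> f (e b) (s b)" using uniq b by blast
    finally show ?thesis .
  qed
  \<comment> \<open>Separation at block \<open>b\<close> is claimed without any bound on the other
    letters. Letters out of range are therefore read as \<open>0\<close>, which makes every
    \<open>s\<close> an admissible word.\<close>
  define x' where "x' = (\<lambda>s. x (\<lambda>b. if s b < 2 ^ q then s b else 0))"
  have sep: "r / L ^ m \<le> dist ((T ^^ (e b * m)) (x' s)) ((T ^^ (e b * m)) (x' s'))"
    if b: "b < M" and s: "s b < 2 ^ q" "s' b < 2 ^ q" "s b \<noteq> s' b" for b and s s' :: "nat \<Rightarrow> nat"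
  proof -
    define t where "t = (\<lambda>b. if s b < 2 ^ q then s b else 0)"
    define t' where "t' = (\<lambda>b. if s' b < 2 ^ q then s' b else 0)"
    have t: "t b < 2 ^ q" "t' b < 2 ^ q" for b unfolding t_def t'_def by auto
    have xs: "x' s = x t" "x' s' = x t'" unfolding x'_def t_def t'_def by auto
    have "t b \<noteq> t' b" using s unfolding t_def t'_def by auto
    then have "f (e b) (t b) \<noteq> f (e b) (t' b)"
      using f[OF eG[OF b]] t by (auto simp: bij_betw_def inj_on_def)
    moreover have "f (e b) (t b) \<subseteq> J (e b)" "f (e b) (t' b) \<subseteq> J (e b)"
      using f[OF eG[OF b]] t by (auto dest!: bij_betwE)
    ultimately obtain i where i: "i \<in> J (e b)" "i \<in> f (e b) (t b) \<longleftrightarrow> i \<notin> f (e b) (t' b)"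
      by blast
    have iW: "i \<in> W" "e b * m \<le> i" "i < e b * m + m" using J(1)[OF eG[OF b]] i(1) by auto
    have "i \<in> V t \<longleftrightarrow> i \<notin> V t'" using block[OF b i(1)] t i(2) by blast
    then have "ball_code T r y (x t) i = Some (i \<in> V t)" "ball_code T r y (x t') i = Some (i \<notin> V t)"
      using x[OF iW(1)] by auto
    then have "r \<le> dist ((T ^^ i) (x t)) ((T ^^ i) (x t'))"
      using dist_triangle[of "(T ^^ i) (x t)" y "(T ^^ i) (x t')"]
        dist_triangle3[of "(T ^^ i) (x t)" y "(T ^^ i) (x t')"]
        dist_triangle3[of "(T ^^ i) (x t')" y "(T ^^ i) (x t)"]
      unfolding ball_code_def by (auto split: if_splits simp: dist_commute)
    \<comment> \<open>The separation seen at time \<open>i\<close> is pulled back to the start of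
      the block, at most \<open>m\<close> steps earlier; each step costs a factor
      \<open>L\<close>.\<close>
    also have "\<dots> = dist ((T ^^ (i - e b * m)) ((T ^^ (e b * m)) (x t)))
        ((T ^^ (i - e b * m)) ((T ^^ (e b * m)) (x t')))"
      using iW funpow_add[of "i - e b * m" "e b * m" T] by (simp add: fun_eq_iff)
    also have "\<dots> \<le> L ^ (i - e b * m) * dist ((T ^^ (e b * m)) (x t)) ((T ^^ (e b * m)) (x t'))"
      by (rule dist_funpow_le[OF L(1)])
    also have "\<dots> \<le> L ^ m * dist ((T ^^ (e b * m)) (x t)) ((T ^^ (e b * m)) (x t'))"
      by (intro mult_right_mono power_increasing) (use L iW in auto)
    finally show ?thesis using L unfolding xs by (simp add: field_simps)
  qed
  show ?thesis
    by (rule exI[of _ M], rule exI[of _ "\<lambda>b. e b * m"], rule exI[of _ x'])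
       (use sep G(2,3) eG in \<open>auto simp: M_def[symmetric]\<close>)
qed

section \<open>Families of measures parametrized by a cube\<close>

text \<open>The easy half of Kantorovich duality: against any coupling, the difference of the
  integrals of a 1-Lipschitz \<open>F\<close> is at most the transport cost.\<close>

lemma W1_distr_pmf_ge:
  fixes u :: "'s \<Rightarrow> 'a::metric_space" and u' :: "'t \<Rightarrow> 'a" and F :: "'a \<Rightarrow> real"
  assumes compact: "compact (UNIV :: 'a set)"
    and F: "\<And>x y. \<bar>F x - F y\<bar> \<le> dist x y"
  shows "\<bar>measure_pmf.expectation P (\<lambda>s. F (u s)) - measure_pmf.expectation P' (\<lambda>s. F (u' s))\<bar>
     \<le> W1 (distr P borel u) (distr P' borel u')"
  unfolding W1_def
proof (rule cINF_greatest)
  \<comment> \<open>The independent coupling shows that the infimum runs over a nonempty set,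
    without which a real \<open>INF\<close> carries no information.\<close>
  have "distr (pair_pmf P P') borel (\<lambda>(s, s'). (u s, u' s')) \<in> couplings (distr P borel u) (distr P' borel u')"
  proof -
    let ?h = "\<lambda>(s, s'). (u s, u' s')"
    have "distr (distr (pair_pmf P P') borel ?h) borel fst = distr (pair_pmf P P') borel (fst \<circ> ?h)"
      by (rule distr_distr) (auto intro!: borel_measurable_continuous_onI continuous_intros)
    also have "fst \<circ> ?h = u \<circ> fst" by auto
    also have "distr (pair_pmf P P') borel (u \<circ> fst) = distr (map_pmf fst (pair_pmf P P')) borel u"
      unfolding map_pmf_rep_eq by (rule distr_distr[symmetric]) auto
    finally have "distr (distr (pair_pmf P P') borel ?h) borel fst = distr P borel u"
      by (simp add: map_fst_pair_pmf)
    moreover have "distr (distr (pair_pmf P P') borel ?h) borel snd = distr (pair_pmf P P') borel (snd \<circ> ?h)"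
      by (rule distr_distr) (auto intro!: borel_measurable_continuous_onI continuous_intros)
    moreover have "snd \<circ> ?h = u' \<circ> snd" by auto
    moreover have "distr (pair_pmf P P') borel (u' \<circ> snd) = distr (map_pmf snd (pair_pmf P P')) borel u'"
      unfolding map_pmf_rep_eq by (rule distr_distr[symmetric]) auto
    ultimately show ?thesis
      unfolding couplings_def borel_probs_def
      by (simp add: map_snd_pair_pmf measure_pmf.prob_space_distr)
  qed
  then show "couplings (distr P borel u) (distr P' borel u') \<noteq> {}" by blast
next
  fix \<gamma> :: "('a \<times> 'a) measure"
  assume \<gamma>: "\<gamma> \<in> couplings (distr P borel u) (distr P' borel u')"
  then have "prob_space \<gamma>" and sets: "sets \<gamma> = sets borel"
    and fst: "distr \<gamma> borel fst = distr P borel u" and snd: "distr \<gamma> borel snd = distr P' borel u'"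
    unfolding couplings_def borel_probs_def by auto
  then interpret prob_space \<gamma> by simp
  have Fcont: "continuous_on UNIV F"
    by (rule lipschitz_on_continuous_on[of 1]) (use F in \<open>auto simp: lipschitz_on_def dist_real_def\<close>)
  then have Fm [measurable]: "F \<in> borel_measurable borel" by (rule borel_measurable_continuous_onI)
  have [measurable]: "fst \<in> borel_measurable \<gamma>" "snd \<in> borel_measurable \<gamma>"
    unfolding measurable_cong_sets[OF sets refl]
    by (auto intro!: borel_measurable_continuous_onI continuous_intros)
  have dm [measurable]: "(\<lambda>z. dist (fst z) (snd z)) \<in> borel_measurable \<gamma>"
    unfolding measurable_cong_sets[OF sets refl]
    by (auto intro!: borel_measurable_continuous_onI continuous_intros)
  obtain D where D: "\<And>x y :: 'a. dist x y \<le> D"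
    using bounded_two_points[THEN iffD1, OF compact_imp_bounded[OF compact]] by auto
  obtain B where B: "\<And>x :: 'a. \<bar>F x\<bar> \<le> B"
    using compact_imp_bounded[OF compact_continuous_image[OF Fcont compact]]
    unfolding bounded_iff by auto
  have int: "integrable \<gamma> (\<lambda>z. F (fst z))" "integrable \<gamma> (\<lambda>z. F (snd z))"
    by (rule integrable_const_bound[of _ B]; simp add: B)+
  have int_dist: "integrable \<gamma> (\<lambda>z. dist (fst z) (snd z))"
    by (rule integrable_const_bound[of _ D]; simp add: D)
  have "measure_pmf.expectation P (\<lambda>s. F (u s)) = (\<integral>x. F x \<partial>distr P borel u)"
    by (rule integral_distr[symmetric]) auto
  also have "\<dots> = (\<integral>z. F (fst z) \<partial>\<gamma>)"
    unfolding fst[symmetric] by (rule integral_distr) auto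
  finally have 1: "measure_pmf.expectation P (\<lambda>s. F (u s)) = (\<integral>z. F (fst z) \<partial>\<gamma>)" .
  have "measure_pmf.expectation P' (\<lambda>s. F (u' s)) = (\<integral>x. F x \<partial>distr P' borel u')"
    by (rule integral_distr[symmetric]) auto
  also have "\<dots> = (\<integral>z. F (snd z) \<partial>\<gamma>)"
    unfolding snd[symmetric] by (rule integral_distr) auto
  finally have 2: "measure_pmf.expectation P' (\<lambda>s. F (u' s)) = (\<integral>z. F (snd z) \<partial>\<gamma>)" .
  have "\<bar>(\<integral>z. F (fst z) \<partial>\<gamma>) - (\<integral>z. F (snd z) \<partial>\<gamma>)\<bar> = \<bar>\<integral>z. F (fst z) - F (snd z) \<partial>\<gamma>\<bar>"
    using int by simp
  also have "\<dots> \<le> (\<integral>z. \<bar>F (fst z) - F (snd z)\<bar> \<partial>\<gamma>)" by (rule integral_abs_bound)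
  also have "\<dots> \<le> (\<integral>z. dist (fst z) (snd z) \<partial>\<gamma>)"
    by (rule integral_mono) (use int int_dist F in auto)
  finally show "\<bar>measure_pmf.expectation P (\<lambda>s. F (u s)) - measure_pmf.expectation P' (\<lambda>s. F (u' s))\<bar>
     \<le> (\<integral>(x, y). dist x y \<partial>\<gamma>)"
    unfolding 1 2 by (simp add: case_prod_unfold)
qed

section \<open>Random words: independent laws in the blocks, parametrized by a cube\<close>

definition unit_cube :: "nat \<Rightarrow> (nat \<Rightarrow> real) set" where
  "unit_cube N = {t. \<forall>i. if i < N then 0 \<le> t i \<and> t i \<le> 1 else t i = 0}"

text \<open>An affine copy of the \<open>k\<close>-dimensional cube in the simplex of laws on
  \<open>k + 1\<close> words. The divisor \<open>k + 1\<close> keeps the first \<open>k\<close>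
  weights at total mass below 1 for every point of the cube, so they vary independently, and word
  \<open>k\<close> takes the remaining mass.\<close>

definition word_weight :: "nat \<Rightarrow> (nat \<Rightarrow> real) \<Rightarrow> nat \<Rightarrow> real" where
  "word_weight k u w =
     (if w < k then u w / (real k + 1) else if w = k then 1 - (\<Sum>v<k. u v / (real k + 1)) else 0)"

definition word_pmf :: "nat \<Rightarrow> (nat \<Rightarrow> real) \<Rightarrow> nat pmf" where
  "word_pmf k u = embed_pmf (word_weight k u)"

lemma pmf_word_pmf:
  assumes "\<And>w. w < k \<Longrightarrow> 0 \<le> u w \<and> u w \<le> 1"
  shows "pmf (word_pmf k u) w = word_weight k u w"
  unfolding word_pmf_def
proof (rule pmf_embed_pmf)
  have "(\<Sum>v<k. u v / (real k + 1)) \<le> (\<Sum>v<k. 1 / (real k + 1))"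
    by (intro sum_mono divide_right_mono) (use assms in auto)
  also have "\<dots> \<le> 1" by (simp add: field_simps)
  finally have *: "(\<Sum>v<k. u v / (real k + 1)) \<le> 1" .
  then show nonneg: "0 \<le> word_weight k u x" for x
    using assms by (auto simp: word_weight_def)
  have "(\<integral>\<^sup>+ x. ennreal (word_weight k u x) \<partial>count_space UNIV) = (\<Sum>x\<le>k. ennreal (word_weight k u x))"
    by (rule nn_integral_count_space') (auto simp: word_weight_def)
  also have "\<dots> = ennreal (\<Sum>x\<le>k. word_weight k u x)"
    by (rule sum_ennreal) (rule nonneg)
  also have "(\<Sum>x\<le>k. word_weight k u x) = 1"
    by (simp add: lessThan_Suc_atMost[symmetric] word_weight_def)
  finally show "(\<integral>\<^sup>+ x. ennreal (word_weight k u x) \<partial>count_space UNIV) = 1" by simp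
qed

text \<open>Coordinate \<open>b * k + w\<close> of the cube governs the probability of word
  \<open>w\<close> in block \<open>b\<close>. Positions from \<open>M\<close> on hold the default
  \<open>0\<close>.\<close>

definition cube_law :: "nat \<Rightarrow> nat \<Rightarrow> (nat \<Rightarrow> real) \<Rightarrow> (nat \<Rightarrow> nat) pmf" where
  "cube_law M k t = Pi_pmf {..<M} 0 (\<lambda>b. word_pmf k (\<lambda>w. t (b * k + w)))"

lemma block_index_less:
  fixes b k w M :: nat
  assumes "b < M" "w < k" shows "b * k + w < M * k"
proof -
  have "b * k + w < Suc b * k" using assms by simp
  also have "\<dots> \<le> M * k" using assms by (intro mult_right_mono) auto
  finally show ?thesis .
qed

lemma pmf_block_word:
  assumes "t \<in> unit_cube (M * k)" "b < M"
  shows "pmf (word_pmf k (\<lambda>w. t (b * k + w))) w = word_weight k (\<lambda>w. t (b * k + w)) w"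
proof (rule pmf_word_pmf)
  fix w assume "w < k"
  from block_index_less[OF assms(2) this] show "0 \<le> t (b * k + w) \<and> t (b * k + w) \<le> 1"
    using assms(1) unfolding unit_cube_def by (auto dest: spec[of _ "b * k + w"])
qed

text \<open>The range of summation is finite and does not depend on \<open>t\<close>, so the
  expectation is a polynomial in the coordinates of \<open>t\<close>; this is the source of
  weak-star continuity.\<close>

lemma expectation_cube_law:
  fixes g :: "(nat \<Rightarrow> nat) \<Rightarrow> real"
  assumes t: "t \<in> unit_cube (M * k)"
  shows "measure_pmf.expectation (cube_law M k t) g =
    (\<Sum>s\<in>PiE_dflt {..<M} 0 (\<lambda>_. {..k}). (\<Prod>b<M. word_weight k (\<lambda>w. t (b * k + w)) (s b)) * g s)"
proof -
  have sub: "set_pmf (cube_law M k t) \<subseteq> PiE_dflt {..<M} 0 (\<lambda>_. {..k})"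
    unfolding cube_law_def using pmf_block_word[OF t]
    by (subst set_Pi_pmf) (auto simp: PiE_dflt_def set_pmf_eq word_weight_def split: if_splits)
  have "measure_pmf.expectation (cube_law M k t) g =
      (\<Sum>s\<in>PiE_dflt {..<M} 0 (\<lambda>_. {..k}). pmf (cube_law M k t) s *\<^sub>R g s)"
    by (rule integral_measure_pmf) (use sub in \<open>auto intro!: finite_PiE_dflt\<close>)
  also have "\<dots> = (\<Sum>s\<in>PiE_dflt {..<M} 0 (\<lambda>_. {..k}). (\<Prod>b<M. word_weight k (\<lambda>w. t (b * k + w)) (s b)) * g s)"
  proof (rule sum.cong[OF refl])
    fix s assume "s \<in> PiE_dflt {..<M} 0 (\<lambda>_. {..k})"
    then have "pmf (cube_law M k t) s = (\<Prod>b<M. pmf (word_pmf k (\<lambda>w. t (b * k + w))) (s b))"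
      unfolding cube_law_def by (subst pmf_Pi') (auto simp: PiE_dflt_def)
    also have "\<dots> = (\<Prod>b<M. word_weight k (\<lambda>w. t (b * k + w)) (s b))"
      by (rule prod.cong) (use pmf_block_word[OF t] in auto)
    finally show "pmf (cube_law M k t) s *\<^sub>R g s = (\<Prod>b<M. word_weight k (\<lambda>w. t (b * k + w)) (s b)) * g s"
      by simp
  qed
  finally show ?thesis .
qed

lemma continuous_on_expectation_cube_law:
  fixes g :: "(nat \<Rightarrow> nat) \<Rightarrow> real"
  shows "continuous_on (unit_cube (M * k)) (\<lambda>t. measure_pmf.expectation (cube_law M k t) g)"
proof -
  have ww: "continuous_on A (\<lambda>t. word_weight k (\<lambda>w. t (b * k + w)) v)" for A b v
    unfolding word_weight_def
    by (cases "v < k"; cases "v = k")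
       (auto intro!: continuous_intros continuous_on_product_then_coordinatewise[OF continuous_on_id])
  have "continuous_on (unit_cube (M * k)) (\<lambda>t. \<Sum>s\<in>PiE_dflt {..<M} 0 (\<lambda>_. {..k}).
      (\<Prod>b<M. word_weight k (\<lambda>w. t (b * k + w)) (s b)) * g s)"
    by (intro continuous_on_sum continuous_on_mult continuous_on_prod ww continuous_on_const)
  then show ?thesis by (rule continuous_on_eq) (simp add: expectation_cube_law)
qed

lemma prob_cube_law_word:
  assumes t: "t \<in> unit_cube (M * k)" and b: "b < M" and w: "w < k"
  shows "measure_pmf.expectation (cube_law M k t) (\<lambda>s. of_bool (s b = w)) = t (b * k + w) / (real k + 1)"
proof -
  have "measure_pmf.expectation (cube_law M k t) (\<lambda>s. of_bool (s b = w) :: real) =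
      measure_pmf.expectation (map_pmf (\<lambda>s. s b) (cube_law M k t)) (\<lambda>v. of_bool (v = w))"
    by (rule integral_map_pmf[symmetric])
  also have "map_pmf (\<lambda>s. s b) (cube_law M k t) = word_pmf k (\<lambda>w. t (b * k + w))"
    unfolding cube_law_def using b by (simp add: Pi_pmf_component)
  also have "measure_pmf.expectation \<dots> (\<lambda>v. of_bool (v = w) :: real) = (\<Sum>v\<in>{w}. pmf (word_pmf k (\<lambda>w. t (b * k + w))) v *\<^sub>R of_bool (v = w))"
    by (rule integral_measure_pmf) auto
  also have "\<dots> = t (b * k + w) / (real k + 1)"
    using pmf_block_word[OF t b] w by (simp add: word_weight_def)
  finally show ?thesis .
qed

section \<open>Weak-star continuity of the push-forward and of the cube of measures\<close>

lemma distr_in_borel_probs: "distr (measure_pmf P) borel x \<in> borel_probs"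
  unfolding borel_probs_def by (auto intro!: measure_pmf.prob_space_distr)

lemma continuous_map_weak_star:
  assumes "h \<in> topspace X \<rightarrow> borel_probs"
    and "\<And>f :: 'a::topological_space \<Rightarrow> real. continuous_on UNIV f \<Longrightarrow> continuous_map X euclideanreal (\<lambda>z. \<integral>x. f x \<partial>h z)"
  shows "continuous_map X weak_star h"
  unfolding weak_star_def
proof (rule continuous_map_pullback')
  show "continuous_map X (product_topology (\<lambda>_. euclideanreal) {f :: 'a \<Rightarrow> real. continuous_on UNIV f})
     ((\<lambda>\<mu>. \<lambda>f\<in>{f. continuous_on UNIV f}. \<integral>x. f x \<partial>\<mu>) \<circ> h)"
    unfolding continuous_map_componentwise using assms(2) by (auto simp: comp_def)
qed (use assms(1) in auto)

lemma topspace_weak_star: "topspace weak_star = borel_probs"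
  unfolding weak_star_def by (auto simp: topspace_pullback_topology)

lemma continuous_map_integral_weak_star:
  fixes f :: "'a::topological_space \<Rightarrow> real"
  assumes "continuous_on UNIV f"
  shows "continuous_map weak_star euclideanreal (\<lambda>\<mu>. \<integral>x. f x \<partial>\<mu>)"
proof -
  have "continuous_map weak_star euclideanreal
      ((\<lambda>p. p f) \<circ> (\<lambda>\<mu>. \<lambda>f\<in>{f. continuous_on UNIV f}. \<integral>x. f x \<partial>\<mu>))"
    unfolding weak_star_def using assms
    by (intro continuous_map_pullback continuous_map_product_projection) auto
  then show ?thesis using assms by (simp add: comp_def)
qed

lemma continuous_map_push_forward:
  fixes T :: "'a::topological_space \<Rightarrow> 'a"
  assumes T: "continuous_on UNIV T"
  shows "continuous_map weak_star weak_star (push_forward T)"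
proof (rule continuous_map_weak_star)
  have Tm: "T \<in> borel_measurable \<mu>" if "sets \<mu> = sets borel" for \<mu>
    unfolding measurable_cong_sets[OF that refl] using T by (rule borel_measurable_continuous_onI)
  show "push_forward T \<in> topspace weak_star \<rightarrow> borel_probs"
    unfolding topspace_weak_star borel_probs_def push_forward_def
  proof (intro funcsetI CollectI conjI)
    fix \<mu> :: "'a measure" assume "\<mu> \<in> {\<mu>. prob_space \<mu> \<and> sets \<mu> = sets borel}"
    then show "prob_space (distr \<mu> borel T)" using prob_space.prob_space_distr Tm by blast
  qed simp
  show "continuous_map weak_star euclideanreal (\<lambda>\<mu>. \<integral>x. f x \<partial>push_forward T \<mu>)"
    if f: "continuous_on UNIV f" for f :: "'a \<Rightarrow> real"
  proof (rule continuous_map_eq)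
    have "continuous_on UNIV (\<lambda>x. f (T x))"
      using continuous_on_compose2[OF f T] by simp
    then show "continuous_map weak_star euclideanreal (\<lambda>\<mu>. \<integral>x. f (T x) \<partial>\<mu>)"
      by (rule continuous_map_integral_weak_star)
    show "(\<integral>x. f (T x) \<partial>\<mu>) = (\<integral>x. f x \<partial>push_forward T \<mu>)" if "\<mu> \<in> topspace weak_star" for \<mu>
      using that Tm f unfolding push_forward_def topspace_weak_star borel_probs_def
      by (subst integral_distr) (auto intro: borel_measurable_continuous_onI)
  qed
qed

lemma push_forward_funpow_distr_pmf:
  fixes T :: "'a::topological_space \<Rightarrow> 'a"
  assumes T: "continuous_on UNIV T"
  shows "(push_forward T ^^ i) (distr (measure_pmf P) borel x) = distr (measure_pmf P) borel (\<lambda>s. (T ^^ i) (x s))"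
proof (induction i)
  case (Suc i)
  then show ?case using borel_measurable_continuous_onI[OF T]
    by (simp add: push_forward_def distr_distr comp_def)
qed simp

lemma continuous_map_cube_measure:
  "continuous_map (top_of_set (unit_cube (M * k))) weak_star
     (\<lambda>t. distr (measure_pmf (cube_law M k t)) borel x)"
proof (rule continuous_map_weak_star)
  fix f :: "'a \<Rightarrow> real" assume "continuous_on UNIV f"
  then have [measurable]: "f \<in> borel_measurable borel" by (rule borel_measurable_continuous_onI)
  show "continuous_map (top_of_set (unit_cube (M * k))) euclideanreal
     (\<lambda>t. \<integral>x. f x \<partial>distr (measure_pmf (cube_law M k t)) borel x)"
    using continuous_on_expectation_cube_law[of M k "\<lambda>s. f (x s)"]
    by (simp add: integral_distr)
qed (auto intro: distr_in_borel_probs)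

text \<open>The test function is the distance to the points whose word in block \<open>b\<close> is
  \<open>w\<close>, cut off at \<xi>. On the points that occur it takes only the values 0 and \<xi>,
  whatever the other blocks contain, so its expectation reads off the probability of
  \<open>w\<close>, which is the coordinate divided by \<open>k + 1\<close>.\<close>

lemma W1_cube_measures_ge:
  fixes x :: "(nat \<Rightarrow> nat) \<Rightarrow> 'a::metric_space"
  assumes compact: "compact (UNIV :: 'a set)" and \<xi>: "\<xi> > 0"
    and sep: "\<And>s s'. s b \<le> k \<Longrightarrow> s' b \<le> k \<Longrightarrow> s b \<noteq> s' b \<Longrightarrow> \<xi> \<le> dist (x s) (x s')"
    and t: "t \<in> unit_cube (M * k)" "t' \<in> unit_cube (M * k)" and b: "b < M" and w: "w < k"
  shows "\<xi> / (real k + 1) * \<bar>t (b * k + w) - t' (b * k + w)\<bar>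
    \<le> W1 (distr (cube_law M k t) borel x) (distr (cube_law M k t') borel x)"
proof -
  define D where "D = {x s |s. s b = w}"
  have D0: "D \<noteq> {}" unfolding D_def by auto
  \<comment> \<open>The separation bounds the distance to \<open>D\<close> only from below; the
    cut-off turns this into an exact value.\<close>
  define F where "F = (\<lambda>z. min \<xi> (infdist z D))"
  have F_lip: "\<bar>F y - F z\<bar> \<le> dist y z" for y z
    using infdist_triangle[of y D z] infdist_triangle[of z D y] unfolding F_def by (auto simp: dist_commute min_def)
  have F_eq: "F (x s) = \<xi> * (1 - of_bool (s b = w))" if "s b \<le> k" for s
  proof (cases "s b = w")
    case True
    then have "infdist (x s) D = 0" by (intro infdist_zero) (auto simp: D_def)
    then show ?thesis using True \<xi> by (simp add: F_def)
  next
    case False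
    have "\<xi> \<le> infdist (x s) D"
      unfolding infdist_def using D0 False sep[of s] that w
      by (auto simp: D_def intro!: cINF_greatest)
    then show ?thesis using False by (simp add: F_def)
  qed
  have E: "measure_pmf.expectation (cube_law M k t) (\<lambda>s. F (x s)) = \<xi> * (1 - t (b * k + w) / (real k + 1))"
    if t: "t \<in> unit_cube (M * k)" for t
  proof -
    have "measure_pmf.expectation (cube_law M k t) (\<lambda>s. F (x s)) =
      measure_pmf.expectation (cube_law M k t) (\<lambda>s. \<xi> * (1 - of_bool (s b = w)))"
      unfolding expectation_cube_law[OF t]
      by (rule sum.cong[OF refl]) (use b F_eq in \<open>auto simp: PiE_dflt_def\<close>)
    also have "\<dots> = \<xi> * (1 - measure_pmf.expectation (cube_law M k t) (\<lambda>s. of_bool (s b = w)))"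
      by (subst integral_mult_right_zero, subst Bochner_Integration.integral_diff)
         (auto intro!: measure_pmf.integrable_const_bound[where B = 1])
    finally show ?thesis unfolding prob_cube_law_word[OF t b w] .
  qed
  have "\<xi> / (real k + 1) * \<bar>t (b * k + w) - t' (b * k + w)\<bar> =
      \<bar>measure_pmf.expectation (cube_law M k t) (\<lambda>s. F (x s)) - measure_pmf.expectation (cube_law M k t') (\<lambda>s. F (x s))\<bar>"
  proof -
    have "\<xi> * (1 - t (b * k + w) / (real k + 1)) - \<xi> * (1 - t' (b * k + w) / (real k + 1)) =
      - (\<xi> / (real k + 1) * (t (b * k + w) - t' (b * k + w)))"
      by (simp add: algebra_simps diff_divide_distrib)
    then show ?thesis unfolding E[OF t(1)] E[OF t(2)] using \<xi> by (simp add: abs_mult)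
  qed
  also have "\<dots> \<le> W1 (distr (cube_law M k t) borel x) (distr (cube_law M k t') borel x)"
    by (rule W1_distr_pmf_ge[OF compact F_lip])
  finally show ?thesis .
qed

section \<open>The Lebesgue covering theorem\<close>

text \<open>The metric on functions is a series with weights \<open>(1/2) ^ n\<close>; the factor 2
  is the sum of the weights.\<close>

lemma dist_fun_le:
  fixes x y :: "'i::countable \<Rightarrow> 'b::metric_space"
  assumes "\<And>i. dist (x i) (y i) \<le> c"
  shows "dist x y \<le> 2 * c"
proof -
  have c: "c \<ge> 0" using assms[of undefined] zero_le_dist order_trans by blast
  have sum: "summable (\<lambda>n. (1/2::real) ^ n * c)" by (intro summable_mult2) (simp add: summable_geometric_iff)
  have "dist x y = (\<Sum>n. (1/2) ^ n * min (dist (x (from_nat n)) (y (from_nat n))) 1)"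
    by (rule dist_fun_def)
  also have "\<dots> \<le> (\<Sum>n. (1/2) ^ n * c)"
  proof (rule suminf_le)
    have le: "(1/2) ^ n * min (dist (x (from_nat n)) (y (from_nat n))) 1 \<le> (1/2) ^ n * c" for n
      by (rule mult_left_mono) (use assms[of "from_nat n"] in auto)
    then show "(1/2) ^ n * min (dist (x (from_nat n)) (y (from_nat n))) 1 \<le> (1/2) ^ n * c" for n .
    show "summable (\<lambda>n. (1/2) ^ n * min (dist (x (from_nat n)) (y (from_nat n))) 1)"
      by (rule summable_comparison_test'[OF sum, of 0]) (use le in \<open>auto simp: abs_mult\<close>)
  qed (rule sum)
  also have "\<dots> = 2 * c"
    using suminf_mult2[of "\<lambda>n. (1/2::real) ^ n" c] suminf_geometric[of "1/2 :: real"]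
    by (simp add: summable_geometric_iff)
  finally show ?thesis .
qed

lemma compact_unit_cube: "compact (unit_cube N)"
proof -
  have "unit_cube N = PiE UNIV (\<lambda>i. if i < N then {0..1} else {0})"
    by (auto simp: unit_cube_def PiE_def Pi_def split: if_splits)
  also have "compact \<dots>"
    using compactin_PiE[of "\<lambda>_. euclidean" UNIV "\<lambda>i. if i < N then {0..1} else {0::real}"]
    by (auto simp: euclidean_product_topology)
  finally show ?thesis .
qed

text \<open>Kuhn's combinatorial lemma (a cubical form of Sperner's) is applied to a fine grid. Each
  grid point is assigned a member of the cover containing a ball around it, and its labels depend on
  that member only. In a completely labelled simplex the \<open>N + 1\<close> different reduced
  labels need \<open>N + 1\<close> different members, and by fineness all of them contain one common
  point. The cover is indexed so that preimages of different sets count separately even if they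
  coincide.\<close>

lemma lebesgue_covering_unit_cube:
  assumes "finite I"
    and op: "\<And>v. v \<in> I \<Longrightarrow> openin (top_of_set (unit_cube N)) (G v)"
    and cover: "unit_cube N \<subseteq> (\<Union>v\<in>I. G v)"
    and faces: "\<And>v i t t'. \<lbrakk>v \<in> I; i < N; t \<in> G v; t' \<in> G v; t i = 0\<rbrakk> \<Longrightarrow> t' i \<noteq> 1"
  shows "\<exists>z\<in>unit_cube N. N + 1 \<le> card {v \<in> I. z \<in> G v}"
proof -
  have "\<exists>U. open U \<and> G v = unit_cube N \<inter> U" if "v \<in> I" for v
    using op[OF that] by (simp add: openin_open)
  then obtain U where U: "\<And>v. v \<in> I \<Longrightarrow> open (U v)" "\<And>v. v \<in> I \<Longrightarrow> G v = unit_cube N \<inter> U v" by metis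
  have "unit_cube N \<subseteq> \<Union>(U ` I)" using cover U(2) by blast
  then obtain e where e: "e > 0" "\<And>x. x \<in> unit_cube N \<Longrightarrow> \<exists>W\<in>U ` I. ball x e \<subseteq> W"
    using Heine_Borel_lemma[OF compact_unit_cube, of N "U ` I"] U(1) by blast
  obtain p :: nat where p: "real p > 2 / e" using reals_Archimedean2 by blast
  then have p0: "p > 0" using e(1) by (metis divide_pos_pos gr0I less_asym of_nat_0 zero_less_numeral)
  \<comment> \<open>Vertices of a simplex differ from its base by at most \<open>1 / p\<close> in
    each coordinate; the factor 2 comes from the metric on functions.\<close>
  have pe: "2 * (1 / real p) < e" using p p0 e(1) by (simp add: field_simps)
  define pt where "pt = (\<lambda>(x :: nat \<Rightarrow> nat) i. if i < N then min 1 (real (x i) / real p) else 0)"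
  have pt: "pt x \<in> unit_cube N" for x unfolding pt_def unit_cube_def by auto
  have "\<exists>v. v \<in> I \<and> ball (pt x) e \<subseteq> U v" for x using e(2)[OF pt] by blast
  then obtain V where V: "\<And>x. V x \<in> I" "\<And>x. ball (pt x) e \<subseteq> U (V x)" by metis
  have ptG: "pt x \<in> G (V x)" for x using V[of x] U(2)[OF V(1)[of x]] pt[of x] e(1) by auto
  \<comment> \<open>Label 1 in direction \<open>j\<close> means that the member meets the face where
    coordinate \<open>j\<close> is 1. By hypothesis such a member misses the opposite face, so the
    labels obey Kuhn's boundary conditions.\<close>
  define vlab where "vlab = (\<lambda>v j. if \<exists>t\<in>G v. t j = 1 then 1 else 0 :: nat)"
  define lab where "lab = (\<lambda>x. vlab (V x))"
  have lab0: "lab x j = 0" if "j < N" "x j = 0" for x j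
  proof -
    have "pt x j = 0" using that by (simp add: pt_def)
    then show ?thesis using faces[OF V(1) that(1) ptG] by (auto simp: lab_def vlab_def)
  qed
  have lab1: "lab x j = 1" if "j < N" "x j = p" for x j
  proof -
    have "pt x j = 1" using that p0 by (simp add: pt_def)
    then show ?thesis using ptG by (auto simp: lab_def vlab_def)
  qed
  have "odd (card {s. ksimplex p N s \<and> (reduced N \<circ> lab) ` s = {..N}})"
    by (rule kuhn_combinatorial[OF p0]) (use lab0 lab1 in auto)
  then have "{s. ksimplex p N s \<and> (reduced N \<circ> lab) ` s = {..N}} \<noteq> {}" by (rule odd_card_imp_not_empty)
  then obtain s b u where "kuhn_simplex p N b u s" and s: "(reduced N \<circ> lab) ` s = {..N}"
    by (auto elim: ksimplex.cases)
  interpret kuhn_simplex p N b u s by fact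
  have "pt b \<in> G (V a)" if a: "a \<in> s" for a
  proof -
    have "dist (pt a i) (pt b i) \<le> 1 / real p" for i
    proof -
      have "b i \<le> a i" "a i \<le> Suc (b i)" using base_le[OF a] le_Suc_base[OF a] by auto
      then have "real (b i) / real p \<le> real (a i) / real p" "real (a i) / real p \<le> real (b i) / real p + 1 / real p"
        using p0 by (auto simp: add_divide_distrib[symmetric] intro!: divide_right_mono)
      then show ?thesis by (auto simp: pt_def dist_real_def)
    qed
    from dist_fun_le[of "pt a" "pt b", OF this] have "dist (pt a) (pt b) < e" using pe by linarith
    then have "pt b \<in> U (V a)" using V(2)[of a] by auto
    then show ?thesis using U(2)[OF V(1)] pt by auto
  qed
  then have "V ` s \<subseteq> {v \<in> I. pt b \<in> G v}" using V(1) by auto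
  then have "card (V ` s) \<le> card {v \<in> I. pt b \<in> G v}" by (rule card_mono[rotated]) (use assms(1) in auto)
  moreover have "N + 1 \<le> card (V ` s)"
  proof -
    have fin: "finite (V ` s)" using V(1) by (intro finite_subset[OF _ assms(1)]) auto
    have "{..N} = (\<lambda>v. reduced N (vlab v)) ` (V ` s)" unfolding s[symmetric] lab_def by (auto simp: image_image)
    then have "card {..N} \<le> card (V ` s)" using card_image_le[OF fin] by metis
    then show ?thesis by simp
  qed
  ultimately show ?thesis using pt by (meson order_trans)
qed

lemma covering_dim_leD:
  assumes "covering_dim_le Z D" "finite \<U>" "\<forall>U\<in>\<U>. openin Z U" "\<Union>\<U> = topspace Z"
  shows "\<exists>\<V>. finite \<V> \<and> (\<forall>V\<in>\<V>. openin Z V) \<and> \<Union>\<V> = topspace Z \<and> (\<forall>V\<in>\<V>. \<exists>U\<in>\<U>. V \<subseteq> U) \<and>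
      (\<forall>z\<in>topspace Z. int (card {V\<in>\<V>. z \<in> V}) \<le> D + 1)"
proof -
  have "finite \<U> \<and> (\<forall>U\<in>\<U>. openin Z U) \<and> \<Union>\<U> = topspace Z" using assms by simp
  then show ?thesis using assms(1) unfolding covering_dim_le_def by (elim allE) (rule mp)
qed

text \<open>The images of opposite faces are disjoint closed sets \<open>A i\<close> and
  \<open>B i\<close>. The sets \<open>U S\<close> remove one of the two for every \<open>i\<close>,
  so they cover \<open>Z\<close>, and no set of a refinement, pulled back to the cube, meets
  opposite faces. The Lebesgue covering theorem then bounds the multiplicity of every refinement
  below by \<open>N + 1\<close>. Separation of opposite faces thus stands in for injectivity of
  \<open>F\<close>.\<close>

lemma covering_dim_le_unit_cube:
  assumes F: "continuous_map (top_of_set (unit_cube N)) Z F" and Z: "Hausdorff_space Z"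
    and disj: "\<And>i t t'. \<lbrakk>i < N; t \<in> unit_cube N; t' \<in> unit_cube N; t i = 0; t' i = 1\<rbrakk> \<Longrightarrow> F t \<noteq> F t'"
    and D: "covering_dim_le Z D"
  shows "int N \<le> D"
proof -
  have cl: "closedin Z (F ` {t \<in> unit_cube N. t i = c})" for i c
  proof (rule compactin_imp_closedin[OF Z image_compactin[OF _ F]])
    have "closed {t :: nat \<Rightarrow> real. t i = c}"
      by (intro closed_Collect_eq continuous_intros continuous_on_product_then_coordinatewise[OF continuous_on_id])
    then have "compact (unit_cube N \<inter> {t. t i = c})" using compact_unit_cube by (rule compact_Int_closed[rotated])
    then show "compactin (top_of_set (unit_cube N)) {t \<in> unit_cube N. t i = c}"
      by (auto simp: compactin_subtopology Int_def)
  qed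
  define A where "A = (\<lambda>i. F ` {t \<in> unit_cube N. t i = 0})"
  define B where "B = (\<lambda>i. F ` {t \<in> unit_cube N. t i = 1})"
  define U where "U = (\<lambda>S. topspace Z - ((\<Union>i\<in>S. A i) \<union> (\<Union>i\<in>{..<N} - S. B i)))"
  have Uop: "openin Z (U S)" if "S \<subseteq> {..<N}" for S
    unfolding U_def A_def B_def using that finite_subset[OF that]
    by (intro openin_diff openin_topspace closedin_Un closedin_Union) (auto intro: cl)
  have Ufin: "finite (U ` Pow {..<N})" by simp
  have Uop': "\<forall>W\<in>U ` Pow {..<N}. openin Z W" using Uop by auto
  have Ucov: "(\<Union>S\<in>Pow {..<N}. U S) = topspace Z"
  proof
    show "topspace Z \<subseteq> (\<Union>S\<in>Pow {..<N}. U S)"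
    proof
      fix z assume z: "z \<in> topspace Z"
      have "z \<notin> B i" if "i < N" "z \<in> A i" for i
        using that disj[of i] unfolding A_def B_def by auto
      then have "z \<in> U {i. i < N \<and> z \<notin> A i}" using z unfolding U_def by auto
      moreover have "{i. i < N \<and> z \<notin> A i} \<in> Pow {..<N}" by auto
      ultimately show "z \<in> (\<Union>S\<in>Pow {..<N}. U S)" by (rule UN_I[rotated])
    qed
  qed (auto simp: U_def)
  obtain \<V> where "finite \<V> \<and> (\<forall>V\<in>\<V>. openin Z V) \<and> \<Union>\<V> = topspace Z \<and>
      (\<forall>V\<in>\<V>. \<exists>W\<in>U ` Pow {..<N}. V \<subseteq> W) \<and> (\<forall>z\<in>topspace Z. int (card {V\<in>\<V>. z \<in> V}) \<le> D + 1)"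
    using covering_dim_leD[OF D Ufin Uop' Ucov] by blast
  then have \<V>: "finite \<V>" "\<And>V. V \<in> \<V> \<Longrightarrow> openin Z V" "\<Union>\<V> = topspace Z"
    "\<And>V. V \<in> \<V> \<Longrightarrow> \<exists>W\<in>U ` Pow {..<N}. V \<subseteq> W"
    "\<And>z. z \<in> topspace Z \<Longrightarrow> int (card {V\<in>\<V>. z \<in> V}) \<le> D + 1"
    by simp_all
  define G where "G = (\<lambda>V. {t \<in> unit_cube N. F t \<in> V})"
  have FZ: "F t \<in> topspace Z" if "t \<in> unit_cube N" for t
    using continuous_map_image_subset_topspace[OF F] that by auto
  have "\<exists>z\<in>unit_cube N. N + 1 \<le> card {V \<in> \<V>. z \<in> G V}"
  proof (rule lebesgue_covering_unit_cube[OF \<V>(1)])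
    show "openin (top_of_set (unit_cube N)) (G V)" if "V \<in> \<V>" for V
      using openin_continuous_map_preimage[OF F \<V>(2)[OF that]] by (simp add: G_def)
    show "unit_cube N \<subseteq> (\<Union>V\<in>\<V>. G V)" using FZ \<V>(3) unfolding G_def by blast
    fix V i t t'
    assume V: "V \<in> \<V>" "i < N" "t \<in> G V" "t' \<in> G V" "t i = 0"
    obtain S where S: "S \<subseteq> {..<N}" "V \<subseteq> U S" using \<V>(4)[OF V(1)] by auto
    have "F t \<in> A i" "F t \<in> U S" "F t' \<in> U S" using V S unfolding A_def G_def by auto
    then have "i \<notin> S" unfolding U_def by auto
    then have "F t' \<notin> B i" using \<open>F t' \<in> U S\<close> V(2) unfolding U_def by auto
    then show "t' i \<noteq> 1" using V(4) unfolding B_def G_def by auto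
  qed
  then obtain z where z: "z \<in> unit_cube N" "N + 1 \<le> card {V \<in> \<V>. F z \<in> V}"
    unfolding G_def by auto
  then show ?thesis using \<V>(5)[OF FZ[OF z(1)]] by linarith
qed

text \<open>If an admissible map identified images of points on opposite faces, one of its fibres
  would have diameter at least \<epsilon>. So its composition with \<open>h\<close> keeps opposite
  faces apart.\<close>

lemma eps_dim_ge_unit_cube:
  assumes h: "continuous_map (top_of_set (unit_cube N)) Y h"
    and sep: "\<And>i t t'. \<lbrakk>i < N; t \<in> unit_cube N; t' \<in> unit_cube N; t i = 0; t' i = 1\<rbrakk> \<Longrightarrow> \<epsilon> \<le> \<rho> (h t) (h t')"
  shows "ereal (real N) \<le> eps_dim Y \<rho> \<epsilon>"
  unfolding eps_dim_def
proof (rule INF_greatest)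
  fix Z :: "(nat \<Rightarrow> real) topology"
  assume "Z \<in> {Z. compact_space Z \<and> metrizable_space Z \<and> (\<exists>f. continuous_map Y Z f \<and> eps_injective Y \<rho> \<epsilon> Z f)}"
  then obtain f where Z: "metrizable_space Z" and f: "continuous_map Y Z f" "eps_injective Y \<rho> \<epsilon> Z f" by auto
  have hY: "h t \<in> topspace Y" if "t \<in> unit_cube N" for t
    using continuous_map_image_subset_topspace[OF h] that by auto
  show "ereal (real N) \<le> covering_dim Z"
    unfolding covering_dim_def
  proof (rule INF_greatest)
    fix D :: int assume "D \<in> {n. -1 \<le> n \<and> covering_dim_le Z n}"
    then have D: "covering_dim_le Z D" by simp
    have "int N \<le> D"
    proof (rule covering_dim_le_unit_cube[OF continuous_map_compose[OF h f(1)] metrizable_imp_Hausdorff_space[OF Z] _ D])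
      fix i t t' assume *: "i < N" "t \<in> unit_cube N" "t' \<in> unit_cube N" "t i = 0" "t' i = 1"
      show "(f \<circ> h) t \<noteq> (f \<circ> h) t'"
      proof
        assume eq: "(f \<circ> h) t = (f \<circ> h) t'"
        define C where "C = {y \<in> topspace Y. f y = f (h t)}"
        have "f (h t) \<in> topspace Z" using continuous_map_image_subset_topspace[OF f(1)] hY[OF *(2)] by auto
        then have less: "diam \<rho> C < ennreal \<epsilon>" using f(2) unfolding eps_injective_def C_def by auto
        have "(h t, h t') \<in> C \<times> C" using eq hY * unfolding C_def by auto
        then have "ennreal (\<rho> (h t) (h t')) \<le> diam \<rho> C"
          unfolding diam_def by (rule SUP_upper2) simp
        moreover have "ennreal \<epsilon> \<le> ennreal (\<rho> (h t) (h t'))" by (rule ennreal_leI[OF sep[OF *]])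
        ultimately show False using less by (metis leD order_trans)
      qed
    qed
    then show "ereal (real N) \<le> ereal (real_of_int D)" by simp
  qed
qed

section \<open>Covering dimension of products\<close>

text \<open>\<open>C\<close> is a chain for the product order, like a monotone lattice path in the
  grid. The sum of the ranks of the two entries increases strictly along it and takes values from 0
  to \<open>card A + card B - 2\<close>.\<close>

lemma card_chain_le:
  fixes C :: "(nat \<times> nat) set"
  assumes C: "C \<subseteq> A \<times> B" and fin: "finite A" "finite B" and ne: "A \<noteq> {}" "B \<noteq> {}"
    and chain: "\<And>i j i' j'. \<lbrakk>(i, j) \<in> C; (i', j') \<in> C; i < i'\<rbrakk> \<Longrightarrow> j \<le> j'"
  shows "card C + 1 \<le> card A + card B"
proof -
  define rk where "rk = (\<lambda>S (k::nat). card {a \<in> S. a < k})"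
  have rk_mono: "rk S k \<le> rk S k'" if "finite S" "k \<le> k'" for S k k'
    unfolding rk_def using that by (intro card_mono) auto
  have rk_strict: "rk S k < rk S k'" if "finite S" "k \<in> S" "k < k'" for S k k'
    unfolding rk_def using that by (intro psubset_card_mono) auto
  have rk_less: "rk S k < card S" if "finite S" "k \<in> S" for S k
    unfolding rk_def using that by (intro psubset_card_mono) auto
  define f where "f = (\<lambda>(i, j). rk A i + rk B j)"
  have f_less: "f (i, j) < f (i', j')" if "(i, j) \<in> C" "i \<le> i'" "j \<le> j'" "(i, j) \<noteq> (i', j')" for i j i' j'
  proof -
    have ij: "i \<in> A" "j \<in> B" using that(1) C by auto
    show ?thesis
    proof (cases "i < i'")
      case True
      then show ?thesis using rk_strict[OF fin(1) ij(1)] rk_mono[OF fin(2) that(3)] unfolding f_def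
        by (simp add: add_less_le_mono)
    next
      case False
      then have "i = i'" "j < j'" using that by auto
      then show ?thesis using rk_strict[OF fin(2) ij(2)] unfolding f_def by simp
    qed
  qed
  have "inj_on f C"
  proof (rule inj_onI, rule ccontr)
    fix p q assume pq: "p \<in> C" "q \<in> C" "f p = f q" "p \<noteq> q"
    obtain i j i' j' where eq: "p = (i, j)" "q = (i', j')" by (metis surj_pair)
    have "(i \<le> i' \<and> j \<le> j') \<or> (i' \<le> i \<and> j' \<le> j)"
      using chain[of i j i' j'] chain[of i' j' i j] pq eq by (metis linorder_le_cases linorder_neqE_nat less_imp_le order_refl)
    then show False using f_less[of i j i' j'] f_less[of i' j' i j] pq eq by auto
  qed
  moreover have "f ` C \<subseteq> {..<card A + card B - 1}"
  proof (rule image_subsetI)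
    fix p assume "p \<in> C"
    then have "rk A (fst p) < card A" "rk B (snd p) < card B" using C rk_less fin by auto
    then show "f p \<in> {..<card A + card B - 1}" unfolding f_def by (auto simp: case_prod_unfold)
  qed
  ultimately have "card C \<le> card {..<card A + card B - 1}" by (rule card_inj_on_le) simp
  moreover have "card A > 0" "card B > 0" using fin ne by (auto simp: card_gt_0_iff)
  ultimately show ?thesis by simp
qed

lemma obtain_crossing:
  fixes f :: "nat \<Rightarrow> real"
  assumes "f 0 < x" "x < f n" "\<And>i. i \<le> n \<Longrightarrow> f i \<noteq> x"
  shows "\<exists>i<n. f i < x \<and> x < f (Suc i)"
  using assms
proof (induction n)
  case (Suc n)
  show ?case
  proof (cases "f n < x")
    case False
    then have "x < f n" using Suc.prems(3)[of n] by auto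
    then show ?thesis using Suc by (metis le_SucI less_SucI)
  qed (use Suc.prems in auto)
qed simp

text \<open>Choose a point of the unit interval different from the finitely many values of
  \<open>f\<close> and \<open>g\<close>; it lies strictly inside one step of each sequence.\<close>

lemma overlapping_steps:
  fixes f g :: "nat \<Rightarrow> real"
  assumes "f 0 = 0" "g 0 = 0" "f a = 1" "g b = 1"
  shows "\<exists>i<a. \<exists>j<b. max (f i) (g j) < min (f (Suc i)) (g (Suc j))"
proof -
  have "infinite ({0<..<1::real} - (f ` {..a} \<union> g ` {..b}))"
    by (intro Diff_infinite_finite) (auto simp: infinite_Ioo)
  then obtain x where "x \<in> {0<..<1::real} - (f ` {..a} \<union> g ` {..b})"
    by (metis finite.emptyI ex_in_conv)
  then have x: "0 < x" "x < 1" "\<And>i. i \<le> a \<Longrightarrow> f i \<noteq> x" "\<And>j. j \<le> b \<Longrightarrow> g j \<noteq> x" by auto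
  obtain i where "i < a" "f i < x" "x < f (Suc i)" using obtain_crossing[of f x a] x assms by auto
  moreover obtain j where "j < b" "g j < x" "x < g (Suc j)" using obtain_crossing[of g x b] x assms by auto
  ultimately show ?thesis by (intro exI[of _ i] exI[of _ j] conjI) auto
qed

lemma continuous_function_positive_on_open:
  assumes "metrizable_space Z" "openin Z U"
  shows "\<exists>\<phi>. continuous_map Z euclideanreal \<phi> \<and> (\<forall>z\<in>topspace Z. 0 \<le> \<phi> z \<and> (0 < \<phi> z \<longleftrightarrow> z \<in> U))"
proof (cases "U = topspace Z")
  \<comment> \<open>Otherwise the function is the distance to the complement of \<open>U\<close>;
    here this would be an infimum over the empty set.\<close>
  case True
  then show ?thesis by (intro exI[of _ "\<lambda>_. 1"]) auto
next
  case False
  obtain M d where M: "Metric_space M d" and Z: "Z = Metric_space.mtopology M d"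
    using assms(1) unfolding metrizable_space_def by blast
  interpret Metric_space M d by fact
  have top: "topspace Z = M" using Z by simp
  have UM: "U \<subseteq> M" using openin_subset[OF assms(2)] top by simp
  define K where "K = M - U"
  have K: "K \<noteq> {}" "K \<subseteq> M" using False UM top unfolding K_def by auto
  define \<phi> where "\<phi> = (\<lambda>z. INF y\<in>K. d z y)"
  have bdd: "bdd_below (d z ` K)" for z by (rule bdd_belowI[of _ 0]) auto
  have nonneg: "0 \<le> \<phi> z" for z unfolding \<phi>_def using K by (intro cINF_greatest) auto
  have tri: "\<phi> x \<le> d x z + \<phi> z" if "x \<in> M" "z \<in> M" for x z
  proof -
    have "\<phi> x - d x z \<le> \<phi> z" unfolding \<phi>_def
    proof (rule cINF_greatest[OF K(1)])
      fix y assume y: "y \<in> K"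
      have "(INF y\<in>K. d x y) \<le> d x y" by (rule cINF_lower[OF bdd y])
      also have "\<dots> \<le> d x z + d z y" using triangle that y K by blast
      finally show "(INF y\<in>K. d x y) - d x z \<le> d z y" by simp
    qed
    then show ?thesis by simp
  qed
  have "continuous_map Z euclideanreal \<phi>"
  proof -
    have "Lipschitz_continuous_map (metric (M, d)) euclidean_metric \<phi>"
      unfolding Lipschitz_continuous_map_def
    proof (intro conjI exI[of _ 1] ballI)
      fix x y assume "x \<in> mspace (metric (M, d))" "y \<in> mspace (metric (M, d))"
      then have "x \<in> M" "y \<in> M" by auto
      then show "mdist euclidean_metric (\<phi> x) (\<phi> y) \<le> 1 * mdist (metric (M, d)) x y"
        using tri[of x y] tri[of y x] commute[of x y] by (auto simp: dist_real_def)
    qed auto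
    from Lipschitz_continuous_imp_continuous_map[OF this] show ?thesis
      by (simp add: Z mtopology_of_def)
  qed
  moreover have "0 < \<phi> z \<longleftrightarrow> z \<in> U" if z: "z \<in> M" for z
  proof
    assume pos: "0 < \<phi> z"
    show "z \<in> U"
    proof (rule ccontr)
      assume "z \<notin> U"
      then have "z \<in> K" using z unfolding K_def by simp
      then have "\<phi> z \<le> d z z" unfolding \<phi>_def by (rule cINF_lower[OF bdd])
      then show False using pos z by simp
    qed
  next
    assume "z \<in> U"
    then obtain r where r: "r > 0" "mball z r \<subseteq> U" using assms(2) unfolding Z openin_mtopology by blast
    have "r \<le> \<phi> z" unfolding \<phi>_def
    proof (rule cINF_greatest[OF K(1)])
      fix y assume "y \<in> K"
      then have "y \<notin> mball z r" "y \<in> M" using r unfolding K_def by auto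
      then show "r \<le> d z y" using z by (auto simp: in_mball)
    qed
    then show "0 < \<phi> z" using r by simp
  qed
  ultimately show ?thesis using nonneg top by (intro exI[of _ \<phi>]) auto
qed

text \<open>These are the partial sums of a partition of unity: at each point they cut the unit
  interval into consecutive pieces, and piece \<open>i\<close> is nondegenerate exactly on
  \<open>U i\<close>.\<close>

lemma subordinate_cumulative_functions:
  assumes Z: "metrizable_space Z" and U: "\<And>i. i < a \<Longrightarrow> openin Z (U i)" and cover: "topspace Z \<subseteq> (\<Union>i<a. U i)"
  shows "\<exists>\<Phi>. (\<forall>i\<le>a. continuous_map Z euclideanreal (\<Phi> i)) \<and>
    (\<forall>z\<in>topspace Z. \<Phi> 0 z = (0::real) \<and> \<Phi> a z = 1 \<and>
      (\<forall>i<a. \<Phi> i z \<le> \<Phi> (Suc i) z \<and> (\<Phi> i z < \<Phi> (Suc i) z \<longleftrightarrow> z \<in> U i)))"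
proof -
  have "\<exists>\<phi>. continuous_map Z euclideanreal \<phi> \<and> (\<forall>z\<in>topspace Z. 0 \<le> \<phi> z \<and> (0 < \<phi> z \<longleftrightarrow> z \<in> U i))" if "i < a" for i
    by (rule continuous_function_positive_on_open[OF Z U[OF that]])
  then obtain \<phi> where \<phi>: "\<And>i. i < a \<Longrightarrow> continuous_map Z euclideanreal (\<phi> i)"
    "\<And>i z. i < a \<Longrightarrow> z \<in> topspace Z \<Longrightarrow> 0 \<le> \<phi> i z" "\<And>i z. i < a \<Longrightarrow> z \<in> topspace Z \<Longrightarrow> 0 < \<phi> i z \<longleftrightarrow> z \<in> U i"
    by metis
  have pos: "0 < (\<Sum>i<a. \<phi> i z)" if "z \<in> topspace Z" for z
  proof -
    obtain i where i: "i < a" "z \<in> U i" using cover \<open>z \<in> topspace Z\<close> by auto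
    show ?thesis
      by (rule sum_pos2[of _ i]) (use i \<phi>(2,3) that in auto)
  qed
  define \<Phi> where "\<Phi> = (\<lambda>n z. (\<Sum>i<n. \<phi> i z) / (\<Sum>i<a. \<phi> i z))"
  have "continuous_map Z euclideanreal (\<Phi> n)" if "n \<le> a" for n
    unfolding \<Phi>_def
  proof (rule continuous_map_real_divide)
    show "continuous_map Z euclideanreal (\<lambda>z. \<Sum>i<n. \<phi> i z)" "continuous_map Z euclideanreal (\<lambda>z. \<Sum>i<a. \<phi> i z)"
      using \<phi>(1) that by (auto intro!: continuous_map_sum)
  qed (use pos in fastforce)
  moreover have "\<Phi> 0 z = 0 \<and> \<Phi> a z = 1 \<and> (\<forall>i<a. \<Phi> i z \<le> \<Phi> (Suc i) z \<and> (\<Phi> i z < \<Phi> (Suc i) z \<longleftrightarrow> z \<in> U i))"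
    if z: "z \<in> topspace Z" for z
    using pos[OF z] \<phi>(2,3)[OF _ z] unfolding \<Phi>_def
    by (auto simp: divide_le_cancel divide_less_cancel)
  ultimately show ?thesis by (intro exI[of _ \<Phi>]) auto
qed

text \<open>The tube argument gives for each \<open>z\<close> a neighbourhood with its own finite
  cover of \<open>W\<close>. Finitely many tubes suffice, and the common refinement of their covers
  of \<open>W\<close> works for all of them at once, so the rectangles form a full product of two
  covers.\<close>

lemma rectangular_refinement:
  assumes Z: "compact_space Z" and W: "compact_space W"
    and op: "\<forall>R\<in>\<O>. openin (prod_topology Z W) R" and cover: "\<Union>\<O> = topspace Z \<times> topspace W"
  shows "\<exists>\<U> \<V>. finite \<U> \<and> (\<forall>U\<in>\<U>. openin Z U) \<and> \<Union>\<U> = topspace Z \<and>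
     finite \<V> \<and> (\<forall>V\<in>\<V>. openin W V) \<and> \<Union>\<V> = topspace W \<and> (\<forall>U\<in>\<U>. \<forall>V\<in>\<V>. \<exists>R\<in>\<O>. U \<times> V \<subseteq> R)"
proof -
  have tube: "\<exists>U \<V>. openin Z U \<and> z \<in> U \<and> finite \<V> \<and> (\<forall>V\<in>\<V>. openin W V) \<and> topspace W \<subseteq> \<Union>\<V> \<and>
      (\<forall>V\<in>\<V>. \<exists>R\<in>\<O>. U \<times> V \<subseteq> R)" if z: "z \<in> topspace Z" for z
  proof -
    have "\<exists>U V. openin Z U \<and> openin W V \<and> z \<in> U \<and> w \<in> V \<and> (\<exists>R\<in>\<O>. U \<times> V \<subseteq> R)" if w: "w \<in> topspace W" for w
    proof -
      have "(z, w) \<in> \<Union>\<O>" using z w cover by simp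
      then obtain R where R: "R \<in> \<O>" "(z, w) \<in> R" by blast
      have "openin (prod_topology Z W) R" using op R by blast
      then show ?thesis using R unfolding openin_prod_topology_alt by meson
    qed
    then obtain U V where UV: "\<And>w. w \<in> topspace W \<Longrightarrow> openin Z (U w)" "\<And>w. w \<in> topspace W \<Longrightarrow> openin W (V w)"
      "\<And>w. w \<in> topspace W \<Longrightarrow> z \<in> U w" "\<And>w. w \<in> topspace W \<Longrightarrow> w \<in> V w"
      "\<And>w. w \<in> topspace W \<Longrightarrow> \<exists>R\<in>\<O>. U w \<times> V w \<subseteq> R"
      by metis
    have "\<exists>\<F>. finite \<F> \<and> \<F> \<subseteq> V ` topspace W \<and> topspace W \<subseteq> \<Union>\<F>"
      using W[unfolded compact_space_def] by (rule compactinD) (use UV in auto)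
    then obtain F where F: "finite F" "F \<subseteq> topspace W" "topspace W \<subseteq> \<Union>(V ` F)"
      by (metis finite_subset_image)
    \<comment> \<open>Intersecting with \<open>topspace Z\<close> gives the right set even if
      \<open>F\<close> is empty, that is, if \<open>W\<close> has no points.\<close>
    define U' where "U' = topspace Z \<inter> (\<Inter>w\<in>F. U w)"
    have "openin Z U'"
      unfolding U'_def using F UV(1) by (cases "F = {}") (auto intro!: openin_Int openin_Inter)
    moreover have "z \<in> U'" using z UV F unfolding U'_def by auto
    moreover have "\<exists>R\<in>\<O>. U' \<times> V w \<subseteq> R" if w: "w \<in> F" for w
    proof -
      obtain R where R: "R \<in> \<O>" "U w \<times> V w \<subseteq> R" using UV(5) w F by blast
      have "U' \<times> V w \<subseteq> U w \<times> V w" unfolding U'_def using w by auto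
      then show ?thesis using R by blast
    qed
    ultimately show ?thesis using F UV(2)
      by (intro exI[of _ U'] exI[of _ "V ` F"]) auto
  qed
  define tb where "tb = (\<lambda>z (U, \<V>). openin Z U \<and> z \<in> U \<and> finite \<V> \<and> (\<forall>V\<in>\<V>. openin W V) \<and>
      topspace W \<subseteq> \<Union>\<V> \<and> (\<forall>V\<in>\<V>. \<exists>R\<in>\<O>. U \<times> V \<subseteq> R))"
  have "\<forall>z\<in>topspace Z. \<exists>p. tb z p" using tube unfolding tb_def by auto
  from bchoice[OF this] obtain g where g: "\<forall>z\<in>topspace Z. tb z (g z)" by (rule exE)
  define U where "U = (\<lambda>z. fst (g z))"
  define \<V> where "\<V> = (\<lambda>z. snd (g z))"
  have U: "\<And>z. z \<in> topspace Z \<Longrightarrow> openin Z (U z)" "\<And>z. z \<in> topspace Z \<Longrightarrow> z \<in> U z"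
    and \<V>: "\<And>z. z \<in> topspace Z \<Longrightarrow> finite (\<V> z)" "\<And>z V. z \<in> topspace Z \<Longrightarrow> V \<in> \<V> z \<Longrightarrow> openin W V"
      "\<And>z. z \<in> topspace Z \<Longrightarrow> topspace W \<subseteq> \<Union>(\<V> z)"
    and sub: "\<And>z V. z \<in> topspace Z \<Longrightarrow> V \<in> \<V> z \<Longrightarrow> \<exists>R\<in>\<O>. U z \<times> V \<subseteq> R"
    using g unfolding tb_def U_def \<V>_def by (auto simp: case_prod_unfold)
  have "\<exists>\<F>. finite \<F> \<and> \<F> \<subseteq> U ` topspace Z \<and> topspace Z \<subseteq> \<Union>\<F>"
    using Z[unfolded compact_space_def] by (rule compactinD) (use U in auto)
  then obtain F where F: "finite F" "F \<subseteq> topspace Z" "topspace Z \<subseteq> \<Union>(U ` F)"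
    by (metis finite_subset_image)
  define \<V>' where "\<V>' = (\<lambda>v. topspace W \<inter> (\<Inter>z\<in>F. v z)) ` PiE F \<V>"
  have "finite \<V>'" unfolding \<V>'_def using F \<V>(1) by (intro finite_imageI finite_PiE) auto
  moreover have opV: "openin W V" if V: "V \<in> \<V>'" for V
  proof -
    obtain v where v: "v \<in> PiE F \<V>" "V = topspace W \<inter> (\<Inter>z\<in>F. v z)" using V unfolding \<V>'_def by auto
    have "openin W (v z)" if "z \<in> F" for z using \<V>(2)[of z "v z"] that v(1) F(2) by (auto dest: PiE_mem)
    then show ?thesis unfolding v(2) using F(1)
      by (cases "F = {}") (auto intro!: openin_Int openin_Inter)
  qed
  moreover have "\<Union>\<V>' = topspace W"
  proof
    show "topspace W \<subseteq> \<Union>\<V>'"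
    proof
      fix w assume w: "w \<in> topspace W"
      have "\<exists>V. V \<in> \<V> z \<and> w \<in> V" if "z \<in> F" for z using \<V>(3)[of z] that F(2) w by blast
      then obtain v where v: "\<And>z. z \<in> F \<Longrightarrow> v z \<in> \<V> z" "\<And>z. z \<in> F \<Longrightarrow> w \<in> v z" by metis
      have "restrict v F \<in> PiE F \<V>" using v by auto
      then have "topspace W \<inter> (\<Inter>z\<in>F. restrict v F z) \<in> \<V>'" unfolding \<V>'_def by (rule imageI)
      moreover have "w \<in> topspace W \<inter> (\<Inter>z\<in>F. restrict v F z)" using w v by auto
      ultimately show "w \<in> \<Union>\<V>'" by (rule UnionI)
    qed
  qed (auto simp: \<V>'_def)
  moreover have "\<Union>(U ` F) = topspace Z"
    using F U(1) openin_subset by (metis UN_least subset_antisym subset_iff)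
  moreover have "\<exists>R\<in>\<O>. U z \<times> V \<subseteq> R" if zV: "z \<in> F" "V \<in> \<V>'" for z V
  proof -
    obtain v where v: "v \<in> PiE F \<V>" "V = topspace W \<inter> (\<Inter>z\<in>F. v z)" using zV unfolding \<V>'_def by auto
    obtain R where R: "R \<in> \<O>" "U z \<times> v z \<subseteq> R" using sub[of z "v z"] v(1) zV(1) F(2) by (auto dest: PiE_mem)
    have "U z \<times> V \<subseteq> U z \<times> v z" unfolding v(2) using zV(1) by auto
    then show ?thesis using R by blast
  qed
  ultimately show ?thesis
    using F(1,2) U(1) by (intro exI[of _ "U ` F"] exI[of _ \<V>']) auto
qed

lemma finite_cover_enumeration:
  assumes "finite \<U>"
  shows "\<exists>a e. \<U> = e ` {..<a::nat} \<and> inj_on e {..<a}"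
  using ex_bij_betw_nat_finite[OF assms] unfolding bij_betw_def atLeast0LessThan by metis

lemma card_indices_eq:
  assumes "inj_on e {..<a::nat}"
  shows "card {i. i < a \<and> z \<in> e i} = card {U \<in> e ` {..<a}. z \<in> U}"
proof -
  have "{U \<in> e ` {..<a}. z \<in> U} = e ` {i. i < a \<and> z \<in> e i}" by auto
  then show ?thesis using assms by (simp add: card_image inj_on_def)
qed

text \<open>The values of the partitions of unity at \<open>z\<close> and at \<open>w\<close> cut the unit interval into two
  systems of subintervals. The new cover records which of them overlap; overlapping pairs of
  indices form a chain, hence there are fewer of them than indices of both systems together.\<close>

lemma covering_dim_le_prod_topology:
  assumes Z: "compact_space Z" "metrizable_space Z" and W: "compact_space W" "metrizable_space W"
    and m: "covering_dim_le Z m" and n: "covering_dim_le W n"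
  shows "covering_dim_le (prod_topology Z W) (m + n)"
  unfolding covering_dim_le_def
proof (intro allI impI, elim conjE)
  fix \<O> :: "('a \<times> 'b) set set"
  assume "finite \<O>" and \<O>: "\<forall>R\<in>\<O>. openin (prod_topology Z W) R" "\<Union>\<O> = topspace (prod_topology Z W)"
  obtain \<U>0 \<V>0 where 0: "finite \<U>0" "\<forall>U\<in>\<U>0. openin Z U" "\<Union>\<U>0 = topspace Z"
     "finite \<V>0" "\<forall>V\<in>\<V>0. openin W V" "\<Union>\<V>0 = topspace W" "\<forall>U\<in>\<U>0. \<forall>V\<in>\<V>0. \<exists>R\<in>\<O>. U \<times> V \<subseteq> R"
    using rectangular_refinement[OF Z(1) W(1) \<O>(1)] \<O>(2) by auto
  obtain \<U> where \<U>: "finite \<U>" "\<forall>U\<in>\<U>. openin Z U" "\<Union>\<U> = topspace Z" "\<forall>V\<in>\<U>. \<exists>U\<in>\<U>0. V \<subseteq> U"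
    "\<forall>z\<in>topspace Z. int (card {V\<in>\<U>. z \<in> V}) \<le> m + 1"
    using covering_dim_leD[OF m 0(1-3)] by blast
  obtain \<V> where \<V>: "finite \<V>" "\<forall>V\<in>\<V>. openin W V" "\<Union>\<V> = topspace W" "\<forall>V\<in>\<V>. \<exists>U\<in>\<V>0. V \<subseteq> U"
    "\<forall>w\<in>topspace W. int (card {V\<in>\<V>. w \<in> V}) \<le> n + 1"
    using covering_dim_leD[OF n 0(4-6)] by blast
  obtain a e where e: "\<U> = e ` {..<a::nat}" "inj_on e {..<a}" using finite_cover_enumeration[OF \<U>(1)] by blast
  obtain b f where f: "\<V> = f ` {..<b::nat}" "inj_on f {..<b}" using finite_cover_enumeration[OF \<V>(1)] by blast
  have "\<And>i. i < a \<Longrightarrow> openin Z (e i)" "topspace Z \<subseteq> (\<Union>i<a. e i)" using \<U>(2,3) e(1) by auto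
  from subordinate_cumulative_functions[OF Z(2) this] obtain \<Phi> where
    "(\<forall>i\<le>a. continuous_map Z euclideanreal (\<Phi> i)) \<and> (\<forall>z\<in>topspace Z. \<Phi> 0 z = (0::real) \<and> \<Phi> a z = 1 \<and>
      (\<forall>i<a. \<Phi> i z \<le> \<Phi> (Suc i) z \<and> (\<Phi> i z < \<Phi> (Suc i) z \<longleftrightarrow> z \<in> e i)))" by blast
  then have \<Phi>: "\<And>i. i \<le> a \<Longrightarrow> continuous_map Z euclideanreal (\<Phi> i)"
    "\<And>z. z \<in> topspace Z \<Longrightarrow> \<Phi> 0 z = (0::real)" "\<And>z. z \<in> topspace Z \<Longrightarrow> \<Phi> a z = 1"
    "\<And>z i. z \<in> topspace Z \<Longrightarrow> i < a \<Longrightarrow> \<Phi> i z \<le> \<Phi> (Suc i) z"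
    "\<And>z i. z \<in> topspace Z \<Longrightarrow> i < a \<Longrightarrow> \<Phi> i z < \<Phi> (Suc i) z \<Longrightarrow> z \<in> e i"
    by blast+
  have "\<And>i. i < b \<Longrightarrow> openin W (f i)" "topspace W \<subseteq> (\<Union>i<b. f i)" using \<V>(2,3) f(1) by auto
  from subordinate_cumulative_functions[OF W(2) this] obtain \<Psi> where
    "(\<forall>i\<le>b. continuous_map W euclideanreal (\<Psi> i)) \<and> (\<forall>z\<in>topspace W. \<Psi> 0 z = (0::real) \<and> \<Psi> b z = 1 \<and>
      (\<forall>i<b. \<Psi> i z \<le> \<Psi> (Suc i) z \<and> (\<Psi> i z < \<Psi> (Suc i) z \<longleftrightarrow> z \<in> f i)))" by blast
  then have \<Psi>: "\<And>j. j \<le> b \<Longrightarrow> continuous_map W euclideanreal (\<Psi> j)"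
    "\<And>w. w \<in> topspace W \<Longrightarrow> \<Psi> 0 w = (0::real)" "\<And>w. w \<in> topspace W \<Longrightarrow> \<Psi> b w = 1"
    "\<And>w j. w \<in> topspace W \<Longrightarrow> j < b \<Longrightarrow> \<Psi> j w \<le> \<Psi> (Suc j) w"
    "\<And>w j. w \<in> topspace W \<Longrightarrow> j < b \<Longrightarrow> \<Psi> j w < \<Psi> (Suc j) w \<Longrightarrow> w \<in> f j"
    by blast+
  define lo where "lo = (\<lambda>(i, j) p. max (\<Phi> i (fst p)) (\<Psi> j (snd p)))"
  define up where "up = (\<lambda>(i, j) p. min (\<Phi> (Suc i) (fst p)) (\<Psi> (Suc j) (snd p)))"
  \<comment> \<open>The two pieces overlap in an interval of positive length; this condition is
    open, unlike mere contact.\<close>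
  define Q where "Q = (\<lambda>ij. {p \<in> topspace (prod_topology Z W). 0 < up ij p - lo ij p})"
  define IJ where "IJ = {..<a} \<times> {..<b}"
  have monoI: "\<Phi> i z \<le> \<Phi> i' z" if "z \<in> topspace Z" "i \<le> i'" "i' \<le> a" for i i' z
    using that(2,3) by (induction i' rule: dec_induct) (use \<Phi>(4)[OF that(1)] in \<open>auto intro: order_trans\<close>)
  have monoJ: "\<Psi> i z \<le> \<Psi> i' z" if "z \<in> topspace W" "i \<le> i'" "i' \<le> b" for i i' z
    using that(2,3) by (induction i' rule: dec_induct) (use \<Psi>(4)[OF that(1)] in \<open>auto intro: order_trans\<close>)
  have Q_sub: "fst p \<in> e i \<and> snd p \<in> f j" if "(i, j) \<in> IJ" "p \<in> Q (i, j)" for i j p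
    using that \<Phi>(5)[of "fst p" i] \<Psi>(5)[of "snd p" j] unfolding Q_def IJ_def lo_def up_def by auto
  have "openin (prod_topology Z W) (Q ij)" if ijIJ: "ij \<in> IJ" for ij
  proof -
    obtain i j where ij: "ij = (i, j)" "i < a" "j < b" using ijIJ unfolding IJ_def by auto
    have c: "continuous_map (prod_topology Z W) euclideanreal (\<lambda>p. \<Phi> k (fst p))" if "k \<le> a" for k
      using continuous_map_compose[OF continuous_map_fst \<Phi>(1)[OF that]] by (simp add: comp_def)
    have c': "continuous_map (prod_topology Z W) euclideanreal (\<lambda>p. \<Psi> k (snd p))" if "k \<le> b" for k
      using continuous_map_compose[OF continuous_map_snd \<Psi>(1)[OF that]] by (simp add: comp_def)
    have "continuous_map (prod_topology Z W) euclideanreal (\<lambda>p. up ij p - lo ij p)"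
      unfolding up_def lo_def ij(1) prod.case
      by (intro continuous_map_diff continuous_map_real_min continuous_map_real_max c c') (use ij in auto)
    from openin_continuous_map_preimage[OF this, of "{0<..}"] show ?thesis unfolding Q_def by simp
  qed
  moreover have "\<Union>(Q ` IJ) = topspace (prod_topology Z W)"
  proof
    show "topspace (prod_topology Z W) \<subseteq> \<Union>(Q ` IJ)"
    proof
      fix p assume p: "p \<in> topspace (prod_topology Z W)"
      then have "fst p \<in> topspace Z" "snd p \<in> topspace W" by auto
      then obtain i j where "i < a" "j < b"
        "max (\<Phi> i (fst p)) (\<Psi> j (snd p)) < min (\<Phi> (Suc i) (fst p)) (\<Psi> (Suc j) (snd p))"
        using overlapping_steps[of "\<lambda>i. \<Phi> i (fst p)" "\<lambda>j. \<Psi> j (snd p)" a b] \<Phi>(2,3) \<Psi>(2,3) by auto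
      then have "p \<in> Q (i, j)" "(i, j) \<in> IJ" using p unfolding Q_def IJ_def lo_def up_def by auto
      then show "p \<in> \<Union>(Q ` IJ)" by blast
    qed
  qed (auto simp: Q_def)
  moreover have "\<exists>R\<in>\<O>. V \<subseteq> R" if V: "V \<in> Q ` IJ" for V
  proof -
    obtain i j where ij: "(i, j) \<in> IJ" "V = Q (i, j)" using V by auto
    have "e i \<in> \<U>" "f j \<in> \<V>" using ij unfolding IJ_def e f by auto
    then obtain U0 V0 where UV0: "U0 \<in> \<U>0" "e i \<subseteq> U0" "V0 \<in> \<V>0" "f j \<subseteq> V0" using \<U>(4) \<V>(4) by blast
    then obtain R where R: "R \<in> \<O>" "U0 \<times> V0 \<subseteq> R" using 0(7) by blast
    have "V \<subseteq> U0 \<times> V0"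
    proof
      fix p assume "p \<in> V"
      then have "fst p \<in> U0" "snd p \<in> V0" using Q_sub[OF ij(1), of p] UV0 ij(2) by blast+
      then show "p \<in> U0 \<times> V0" by (cases p) auto
    qed
    then show ?thesis using R by blast
  qed
  moreover have "int (card {V \<in> Q ` IJ. p \<in> V}) \<le> m + n + 1" if p: "p \<in> topspace (prod_topology Z W)" for p
  proof -
    have pZW: "fst p \<in> topspace Z" "snd p \<in> topspace W" using p by auto
    define A where "A = {i. i < a \<and> fst p \<in> e i}"
    define B where "B = {j. j < b \<and> snd p \<in> f j}"
    define C where "C = {ij \<in> IJ. p \<in> Q ij}"
    have finC: "finite C" unfolding C_def IJ_def by auto
    have "{V \<in> Q ` IJ. p \<in> V} = Q ` C" unfolding C_def by auto
    then have "card {V \<in> Q ` IJ. p \<in> V} \<le> card C" using card_image_le[OF finC] by simp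
    \<comment> \<open>The 1 saved on a chain turns the two bounds \<open>m + 1\<close> and
      \<open>n + 1\<close> into \<open>m + n + 1\<close>.\<close>
    moreover have "card C + 1 \<le> card A + card B"
    proof (rule card_chain_le)
      show "C \<subseteq> A \<times> B"
      proof
        fix ij assume ijC: "ij \<in> C"
        obtain i j where ij: "ij = (i, j)" by (metis surj_pair)
        then show "ij \<in> A \<times> B" using ijC Q_sub[of i j p] unfolding A_def B_def C_def IJ_def by auto
      qed
      show "finite A" "finite B" unfolding A_def B_def by auto
      show "A \<noteq> {}" using pZW(1) \<U>(3) e(1) unfolding A_def by auto
      show "B \<noteq> {}" using pZW(2) \<V>(3) f(1) unfolding B_def by auto
      fix i j i' j' assume ij: "(i, j) \<in> C" "(i', j') \<in> C" "i < i'"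
      show "j \<le> j'"
      proof (rule ccontr)
        assume "\<not> j \<le> j'"
        \<comment> \<open>If \<open>j' < j\<close>, piece \<open>i\<close> lies left of piece
          \<open>i'\<close> while piece \<open>j\<close> lies right of piece \<open>j'\<close>; then
          \<open>i\<close> and \<open>j\<close> cannot overlap at the same time as \<open>i'\<close>
          and \<open>j'\<close>.\<close>
        then have "\<Psi> (Suc j') (snd p) \<le> \<Psi> j (snd p)" using ij unfolding C_def IJ_def by (intro monoJ pZW) auto
        moreover have "\<Phi> (Suc i) (fst p) \<le> \<Phi> i' (fst p)" using ij unfolding C_def IJ_def by (intro monoI pZW) auto
        ultimately show False using ij unfolding C_def Q_def lo_def up_def by auto
      qed
    qed
    moreover have "int (card A) \<le> m + 1"
      unfolding A_def card_indices_eq[OF e(2)] using \<U>(5) pZW(1) e(1) by auto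
    moreover have "int (card B) \<le> n + 1"
      unfolding B_def card_indices_eq[OF f(2)] using \<V>(5) pZW(2) f(1) by auto
    ultimately show ?thesis by linarith
  qed
  moreover have "finite (Q ` IJ)" unfolding IJ_def by simp
  ultimately show "\<exists>\<V>. finite \<V> \<and> (\<forall>V\<in>\<V>. openin (prod_topology Z W) V) \<and> \<Union>\<V> = topspace (prod_topology Z W) \<and>
      (\<forall>V\<in>\<V>. \<exists>U\<in>\<O>. V \<subseteq> U) \<and> (\<forall>z\<in>topspace (prod_topology Z W). int (card {V \<in> \<V>. z \<in> V}) \<le> m + n + 1)"
    by (intro exI[of _ "Q ` IJ"]) auto
qed

section \<open>Metric mean dimension as a limit\<close>

lemma covering_dim_le_homeomorphic:
  assumes h: "homeomorphic_maps P Q f g" and P: "covering_dim_le P n"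
  shows "covering_dim_le Q n"
  unfolding covering_dim_le_def
proof (intro allI impI, elim conjE)
  fix \<U> assume \<U>: "finite \<U>" "\<forall>U\<in>\<U>. openin Q U" "\<Union>\<U> = topspace Q"
  have f: "continuous_map P Q f" and g: "continuous_map Q P g"
    and fg: "\<And>y. y \<in> topspace Q \<Longrightarrow> f (g y) = y" and gf: "\<And>x. x \<in> topspace P \<Longrightarrow> g (f x) = x"
    using h unfolding homeomorphic_maps_def by auto
  have fP: "f x \<in> topspace Q" if "x \<in> topspace P" for x
    using continuous_map_image_subset_topspace[OF f] that by auto
  have gQ: "g y \<in> topspace P" if "y \<in> topspace Q" for y
    using continuous_map_image_subset_topspace[OF g] that by auto
  define \<U>' where "\<U>' = (\<lambda>U. {x \<in> topspace P. f x \<in> U}) ` \<U>"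
  have "finite \<U>'" "\<forall>U\<in>\<U>'. openin P U" "\<Union>\<U>' = topspace P"
    using \<U> fP openin_continuous_map_preimage[OF f] unfolding \<U>'_def by auto
  from covering_dim_leD[OF P this] obtain \<V>' where \<V>': "finite \<V>'" "\<forall>V\<in>\<V>'. openin P V" "\<Union>\<V>' = topspace P"
    "\<forall>V\<in>\<V>'. \<exists>U\<in>\<U>'. V \<subseteq> U" "\<forall>z\<in>topspace P. int (card {V\<in>\<V>'. z \<in> V}) \<le> n + 1" by blast
  define k where "k = (\<lambda>V. {y \<in> topspace Q. g y \<in> V})"
  have "finite (k ` \<V>')" "\<forall>V\<in>k ` \<V>'. openin Q V" "\<Union>(k ` \<V>') = topspace Q"
    using \<V>' gQ openin_continuous_map_preimage[OF g] unfolding k_def by auto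
  moreover have "\<exists>U\<in>\<U>. V \<subseteq> U" if V: "V \<in> k ` \<V>'" for V
  proof -
    obtain V' where V': "V' \<in> \<V>'" "V = k V'" using V by blast
    obtain U where U: "U \<in> \<U>" "V' \<subseteq> {x \<in> topspace P. f x \<in> U}" using \<V>'(4) V'(1) unfolding \<U>'_def by blast
    have "V \<subseteq> U"
    proof
      fix y assume "y \<in> V"
      then have y: "y \<in> topspace Q" "g y \<in> V'" unfolding V'(2) k_def by auto
      then have "f (g y) \<in> U" using U(2) by blast
      then show "y \<in> U" using fg[OF y(1)] by simp
    qed
    then show ?thesis using U(1) by blast
  qed
  moreover have "int (card {V \<in> k ` \<V>'. y \<in> V}) \<le> n + 1" if y: "y \<in> topspace Q" for y
  proof -
    have "{V \<in> k ` \<V>'. y \<in> V} = k ` {V \<in> \<V>'. g y \<in> V}" using y unfolding k_def by auto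
    then have "card {V \<in> k ` \<V>'. y \<in> V} \<le> card {V \<in> \<V>'. g y \<in> V}"
      using card_image_le[of "{V \<in> \<V>'. g y \<in> V}" k] \<V>'(1) by simp
    moreover have "int (card {V \<in> \<V>'. g y \<in> V}) \<le> n + 1" using \<V>'(5) gQ[OF y] by (rule bspec)
    ultimately show ?thesis by linarith
  qed
  ultimately show "\<exists>\<V>. finite \<V> \<and> (\<forall>V\<in>\<V>. openin Q V) \<and> \<Union>\<V> = topspace Q \<and> (\<forall>V\<in>\<V>. \<exists>U\<in>\<U>. V \<subseteq> U) \<and>
      (\<forall>z\<in>topspace Q. int (card {V \<in> \<V>. z \<in> V}) \<le> n + 1)"
    by (intro exI[of _ "k ` \<V>'"]) auto
qed

text \<open>Transports a space along an injection into another type; the image receives its topology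
  from \<open>P\<close> alone.\<close>

lemma homeomorphic_maps_pullback_topology:
  assumes gf: "\<And>x. g (f x) = x"
  shows "homeomorphic_maps P (pullback_topology (f ` topspace P) g P) f g"
  unfolding homeomorphic_maps_def
proof (intro conjI ballI)
  have "g \<circ> f = id" using gf by auto
  then show "continuous_map P (pullback_topology (f ` topspace P) g P) f"
    by (intro continuous_map_pullback') auto
  show "continuous_map (pullback_topology (f ` topspace P) g P) P g"
    using continuous_map_pullback[OF continuous_map_id, of "f ` topspace P" g P] by simp
  show "g (f x) = x" for x by (rule gf)
  show "f (g y) = y" if "y \<in> topspace (pullback_topology (f ` topspace P) g P)" for y
    using that gf by (auto simp: topspace_pullback_topology)
qed

text \<open>\<open>eps_dim\<close> only ranges over topologies on sequences. This bijection between
  pairs of sequences and sequences brings the product of two such spaces back into that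
  type.\<close>

definition interleave :: "(nat \<Rightarrow> 'a) \<times> (nat \<Rightarrow> 'a) \<Rightarrow> nat \<Rightarrow> 'a" where
  "interleave p n = (if even n then fst p (n div 2) else snd p (n div 2))"

definition deinterleave :: "(nat \<Rightarrow> 'a) \<Rightarrow> (nat \<Rightarrow> 'a) \<times> (nat \<Rightarrow> 'a)" where
  "deinterleave x = (\<lambda>n. x (2 * n), \<lambda>n. x (2 * n + 1))"

lemma deinterleave_interleave: "deinterleave (interleave p) = p"
  by (cases p) (simp add: deinterleave_def interleave_def)

definition interleave_topology ::
  "(nat \<Rightarrow> 'a) topology \<Rightarrow> (nat \<Rightarrow> 'a) topology \<Rightarrow> (nat \<Rightarrow> 'a) topology" where
  "interleave_topology Z W =
     pullback_topology (interleave ` topspace (prod_topology Z W)) deinterleave (prod_topology Z W)"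

lemma homeomorphic_maps_interleave:
  "homeomorphic_maps (prod_topology Z W) (interleave_topology Z W) interleave deinterleave"
  unfolding interleave_topology_def
  by (rule homeomorphic_maps_pullback_topology) (rule deinterleave_interleave)

section \<open>Dimension at a fixed scale and its subadditivity along orbits\<close>

lemma eps_dim_le:
  fixes Z :: "(nat \<Rightarrow> real) topology"
  assumes "compact_space Z" "metrizable_space Z" "continuous_map Y Z f" "eps_injective Y \<rho> \<epsilon> Z f"
    and "-1 \<le> D" "covering_dim_le Z D"
  shows "eps_dim Y \<rho> \<epsilon> \<le> ereal (real_of_int D)"
proof -
  have "eps_dim Y \<rho> \<epsilon> \<le> covering_dim Z"
    unfolding eps_dim_def by (rule INF_lower) (use assms in auto)
  also have "\<dots> \<le> ereal (real_of_int D)"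
    unfolding covering_dim_def by (rule INF_lower) (use assms in auto)
  finally show ?thesis .
qed

text \<open>The infimum is over integers bounded below by -1, so a finite value has an actual space,
  map and dimension bound as witnesses.\<close>

lemma eps_dim_attained:
  fixes Y :: "'y topology"
  assumes "eps_dim Y \<rho> \<epsilon> < \<infinity>"
  shows "\<exists>(Z :: (nat \<Rightarrow> real) topology) f D. compact_space Z \<and> metrizable_space Z \<and> continuous_map Y Z f \<and>
    eps_injective Y \<rho> \<epsilon> Z f \<and> -1 \<le> D \<and> covering_dim_le Z D \<and> eps_dim Y \<rho> \<epsilon> = ereal (real_of_int D)"
proof -
  define ok where "ok = (\<lambda>D (Z :: (nat \<Rightarrow> real) topology) f. compact_space Z \<and> metrizable_space Z \<and>
    continuous_map Y Z f \<and> eps_injective Y \<rho> \<epsilon> Z f \<and> -1 \<le> D \<and> covering_dim_le Z D)"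
  have "\<exists>D. \<exists>Z f. ok D Z f"
    using assms unfolding eps_dim_def covering_dim_def INF_less_iff ok_def by blast
  then obtain D0 where "\<exists>Z f. ok D0 Z f" by blast
  from ex_has_least_nat[of "\<lambda>D. \<exists>Z f. ok D Z f", OF this, of "\<lambda>D. nat (D + 1)"]
  obtain D where D: "\<exists>Z f. ok D Z f" and least: "\<forall>D'. (\<exists>Z f. ok D' Z f) \<longrightarrow> nat (D + 1) \<le> nat (D' + 1)" by blast
  obtain Z f where Zf: "ok D Z f" using D by blast
  have "eps_dim Y \<rho> \<epsilon> = ereal (real_of_int D)"
  proof (rule antisym)
    show "eps_dim Y \<rho> \<epsilon> \<le> ereal (real_of_int D)" using Zf eps_dim_le unfolding ok_def by blast
    have "D \<le> D'" if ok': "ok D' Z' f'" for D' Z' f'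
    proof -
      have "nat (D + 1) \<le> nat (D' + 1)" using least ok' by blast
      then show ?thesis using ok' Zf unfolding ok_def by linarith
    qed
    then show "ereal (real_of_int D) \<le> eps_dim Y \<rho> \<epsilon>"
      unfolding eps_dim_def covering_dim_def ok_def by (intro INF_greatest) auto
  qed
  then show ?thesis using Zf unfolding ok_def by blast
qed

text \<open>A point of \<open>Y\<close> gives a point of \<open>Z\<close>, which every cover must
  contain at least once. This excludes the value -1, which belongs to the empty space.\<close>

lemma eps_dim_nonneg:
  assumes "topspace Y \<noteq> {}"
  shows "0 \<le> eps_dim Y \<rho> \<epsilon>"
proof (rule ccontr)
  assume "\<not> ?thesis"
  then have "eps_dim Y \<rho> \<epsilon> < 0" by simp
  moreover from this have "eps_dim Y \<rho> \<epsilon> < \<infinity>" by (rule less_trans) simp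
  ultimately obtain Z :: "(nat \<Rightarrow> real) topology" and f D where
    f: "continuous_map Y Z f" and D: "covering_dim_le Z D" "ereal (real_of_int D) < 0"
    using eps_dim_attained[of Y \<rho> \<epsilon>] by metis
  obtain y where y: "y \<in> topspace Y" using assms by blast
  have z: "f y \<in> topspace Z" using continuous_map_image_subset_topspace[OF f] y by auto
  obtain \<V> where \<V>: "finite \<V>" "\<Union>\<V> = topspace Z" "\<forall>z\<in>topspace Z. int (card {V\<in>\<V>. z \<in> V}) \<le> D + 1"
    using covering_dim_leD[OF D(1), of "{topspace Z}"] by auto
  have "{V\<in>\<V>. f y \<in> V} \<noteq> {}" using \<V>(2) z by auto
  then have "card {V\<in>\<V>. f y \<in> V} > 0" using \<V>(1) by (simp add: card_gt_0_iff)
  moreover have "int (card {V\<in>\<V>. f y \<in> V}) \<le> D + 1" using \<V>(3) z by (rule bspec)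
  ultimately have "0 \<le> D" by linarith
  then show False using D(2) by simp
qed

lemma eps_dim_mono:
  fixes Y :: "'y topology"
  assumes "\<And>x y. x \<in> topspace Y \<Longrightarrow> y \<in> topspace Y \<Longrightarrow> \<rho> x y \<le> \<rho>' x y"
  shows "eps_dim Y \<rho> \<epsilon> \<le> eps_dim Y \<rho>' \<epsilon>"
proof -
  have "diam \<rho> C \<le> diam \<rho>' C" if C: "C \<subseteq> topspace Y" for C
    unfolding diam_def
  proof (rule SUP_mono, clarify)
    fix x y assume xy: "x \<in> C" "y \<in> C"
    then have "ennreal (\<rho> x y) \<le> ennreal (\<rho>' x y)" using assms C by (intro ennreal_leI) auto
    then show "\<exists>p\<in>C \<times> C. ennreal (\<rho> x y) \<le> (case p of (x, y) \<Rightarrow> ennreal (\<rho>' x y))"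
      using xy by (intro bexI[of _ "(x, y)"]) auto
  qed
  then have "diam \<rho> {y \<in> topspace Y. f y = z} \<le> diam \<rho>' {y \<in> topspace Y. f y = z}" for f :: "'y \<Rightarrow> nat \<Rightarrow> real" and z
    by (simp add: subset_iff)
  then have "eps_injective Y \<rho> \<epsilon> Z f" if "eps_injective Y \<rho>' \<epsilon> Z f" for Z :: "(nat \<Rightarrow> real) topology" and f
    using that le_less_trans unfolding eps_injective_def by blast
  then have "{Z :: (nat \<Rightarrow> real) topology. compact_space Z \<and> metrizable_space Z \<and> (\<exists>f. continuous_map Y Z f \<and> eps_injective Y \<rho>' \<epsilon> Z f)}
      \<subseteq> {Z. compact_space Z \<and> metrizable_space Z \<and> (\<exists>f. continuous_map Y Z f \<and> eps_injective Y \<rho> \<epsilon> Z f)}"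
    by blast
  then show ?thesis unfolding eps_dim_def by (rule INF_superset_mono) simp
qed

lemma dyn_metric_add_le:
  assumes "0 < m" "0 < n"
  shows "dyn_metric S \<rho> (m + n) x y \<le> max (dyn_metric S \<rho> m x y) (dyn_metric S \<rho> n ((S ^^ m) x) ((S ^^ m) y))"
proof -
  have "\<rho> ((S ^^ i) x) ((S ^^ i) y) \<le> max (dyn_metric S \<rho> m x y) (dyn_metric S \<rho> n ((S ^^ m) x) ((S ^^ m) y))"
    if i: "i < m + n" for i
  proof (cases "i < m")
    case True
    then show ?thesis using dyn_metric_ge[OF True, of \<rho> S x y] by simp
  next
    case False
    then have "i - m < n" using i by simp
    moreover have "(S ^^ (i - m)) ((S ^^ m) u) = (S ^^ i) u" for u
      using False funpow_add[of "i - m" m S] by (simp add: fun_eq_iff)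
    ultimately show ?thesis using dyn_metric_ge[of "i - m" n \<rho> S "(S ^^ m) x" "(S ^^ m) y"] by simp
  qed
  then show ?thesis using assms by (subst dyn_metric_le_iff) auto
qed

lemma continuous_map_funpow:
  assumes "continuous_map Y Y S"
  shows "continuous_map Y Y (S ^^ n)"
proof (induction n)
  case (Suc n)
  show ?case using continuous_map_compose[OF Suc assms] by (simp add: comp_def)
qed (simp add: id_def[symmetric])

text \<open>If \<open>f\<close> is admissible for the first \<open>m\<close> times and
  \<open>g\<close> for \<open>n\<close> times, the map sending \<open>y\<close> to the pair of
  \<open>f y\<close> and \<open>g ((S ^^ m) y)\<close> controls all \<open>m + n\<close> times. The
  product inequality bounds the dimension of its target.\<close>

lemma eps_dim_dyn_metric_subadditive:
  assumes S: "continuous_map Y Y S" and ne: "topspace Y \<noteq> {}" and mn: "0 < m" "0 < n"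
  shows "eps_dim Y (dyn_metric S \<rho> (m + n)) \<epsilon> \<le> eps_dim Y (dyn_metric S \<rho> m) \<epsilon> + eps_dim Y (dyn_metric S \<rho> n) \<epsilon>"
proof (cases "eps_dim Y (dyn_metric S \<rho> m) \<epsilon> < \<infinity> \<and> eps_dim Y (dyn_metric S \<rho> n) \<epsilon> < \<infinity>")
  case False
  then have "eps_dim Y (dyn_metric S \<rho> m) \<epsilon> = \<infinity> \<or> eps_dim Y (dyn_metric S \<rho> n) \<epsilon> = \<infinity>" by auto
  then show ?thesis using eps_dim_nonneg[OF ne, of "dyn_metric S \<rho> m" \<epsilon>] eps_dim_nonneg[OF ne, of "dyn_metric S \<rho> n" \<epsilon>]
    by auto
next
  case True
  obtain Z f D where Z: "compact_space Z" "metrizable_space Z" "continuous_map Y (Z :: (nat \<Rightarrow> real) topology) f"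
    "eps_injective Y (dyn_metric S \<rho> m) \<epsilon> Z f" "covering_dim_le Z D"
    and eqD: "eps_dim Y (dyn_metric S \<rho> m) \<epsilon> = ereal (real_of_int D)"
    using eps_dim_attained[of Y "dyn_metric S \<rho> m" \<epsilon>] True by blast
  obtain W g E where W: "compact_space W" "metrizable_space W" "continuous_map Y (W :: (nat \<Rightarrow> real) topology) g"
    "eps_injective Y (dyn_metric S \<rho> n) \<epsilon> W g" "covering_dim_le W E"
    and eqE: "eps_dim Y (dyn_metric S \<rho> n) \<epsilon> = ereal (real_of_int E)"
    using eps_dim_attained[of Y "dyn_metric S \<rho> n" \<epsilon>] True by blast
  have nonneg: "0 \<le> D" "0 \<le> E"
    using eps_dim_nonneg[OF ne, of "dyn_metric S \<rho> m" \<epsilon>] eps_dim_nonneg[OF ne, of "dyn_metric S \<rho> n" \<epsilon>]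
    unfolding eqD eqE by auto
  let ?P = "prod_topology Z W" and ?Q = "interleave_topology Z W"
  have hom: "?P homeomorphic_space ?Q"
    using homeomorphic_maps_interleave unfolding homeomorphic_space_def by blast
  have compact: "compact_space ?P" using Z(1) W(1) by (simp add: compact_space_prod_topology)
  have metr: "metrizable_space ?P" using Z(2) W(2) by (simp add: metrizable_space_prod_topology)
  define h where "h = (\<lambda>y. (f y, g ((S ^^ m) y)))"
  have "continuous_map Y ?P h"
    unfolding h_def using continuous_map_compose[OF continuous_map_funpow[OF S] W(3)] Z(3)
    by (intro continuous_map_pairedI) (auto simp: comp_def)
  then have cont: "continuous_map Y ?Q (interleave \<circ> h)"
    using homeomorphic_maps_interleave continuous_map_compose unfolding homeomorphic_maps_def by blast
  have inj: "eps_injective Y (dyn_metric S \<rho> (m + n)) \<epsilon> ?Q (interleave \<circ> h)"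
    unfolding eps_injective_def
  proof
    fix z assume "z \<in> topspace ?Q"
    then obtain u v where uv: "u \<in> topspace Z" "v \<in> topspace W" "z = interleave (u, v)"
      unfolding interleave_topology_def by (auto simp: topspace_pullback_topology)
    define C1 where "C1 = {y \<in> topspace Y. f y = u}"
    define C2 where "C2 = {y \<in> topspace Y. g y = v}"
    define C where "C = {y \<in> topspace Y. (interleave \<circ> h) y = z}"
    have in_C: "y \<in> C1 \<and> (S ^^ m) y \<in> C2" if "y \<in> C" for y
    proof -
      have y: "y \<in> topspace Y" "interleave (h y) = interleave (u, v)" using that uv unfolding C_def by auto
      have "h y = (u, v)" using arg_cong[OF y(2), of deinterleave] by (simp add: deinterleave_interleave)
      moreover have "(S ^^ m) y \<in> topspace Y"
        using continuous_map_image_subset_topspace[OF continuous_map_funpow[OF S]] y(1) by auto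
      ultimately show ?thesis using y unfolding C1_def C2_def h_def by auto
    qed
    have "diam (dyn_metric S \<rho> (m + n)) C \<le> max (diam (dyn_metric S \<rho> m) C1) (diam (dyn_metric S \<rho> n) C2)"
      unfolding diam_def[of _ C]
    proof (rule SUP_least, clarify)
      fix x y assume xy: "x \<in> C" "y \<in> C"
      have 1: "ennreal (dyn_metric S \<rho> m x y) \<le> diam (dyn_metric S \<rho> m) C1"
        unfolding diam_def by (rule SUP_upper2[of "(x, y)"]) (use in_C xy in auto)
      have 2: "ennreal (dyn_metric S \<rho> n ((S ^^ m) x) ((S ^^ m) y)) \<le> diam (dyn_metric S \<rho> n) C2"
        unfolding diam_def by (rule SUP_upper2[of "((S ^^ m) x, (S ^^ m) y)"]) (use in_C xy in auto)
      have "ennreal (dyn_metric S \<rho> (m + n) x y) \<le>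
          ennreal (max (dyn_metric S \<rho> m x y) (dyn_metric S \<rho> n ((S ^^ m) x) ((S ^^ m) y)))"
        by (intro ennreal_leI dyn_metric_add_le mn)
      also have "\<dots> \<le> max (diam (dyn_metric S \<rho> m) C1) (diam (dyn_metric S \<rho> n) C2)"
        using 1 2 by (auto simp: max_def intro: order_trans)
      finally show "ennreal (dyn_metric S \<rho> (m + n) x y) \<le> max (diam (dyn_metric S \<rho> m) C1) (diam (dyn_metric S \<rho> n) C2)" .
    qed
    also have "\<dots> < ennreal \<epsilon>"
      using Z(4) W(4) uv unfolding eps_injective_def C1_def C2_def by auto
    finally show "diam (dyn_metric S \<rho> (m + n)) {y \<in> topspace Y. (interleave \<circ> h) y = z} < ennreal \<epsilon>"
      unfolding C_def .
  qed
  have "eps_dim Y (dyn_metric S \<rho> (m + n)) \<epsilon> \<le> ereal (real_of_int (D + E))"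
  proof (rule eps_dim_le[OF _ _ cont inj])
    show "compact_space ?Q" using compact homeomorphic_compact_space[OF hom] by simp
    show "metrizable_space ?Q" using metr homeomorphic_metrizable_space[OF hom] by simp
    show "covering_dim_le ?Q (D + E)"
      by (rule covering_dim_le_homeomorphic[OF homeomorphic_maps_interleave
            covering_dim_le_prod_topology[OF Z(1,2) W(1,2) Z(5) W(5)]])
  qed (use nonneg in simp)
  then show ?thesis unfolding eqD eqE by simp
qed

text \<open>Fekete's lemma. Monotonicity allows rounding \<open>n\<close> up to a multiple of
  \<open>k\<close>, so no separate estimate for the remainder is required.\<close>

lemma subadditive_average_tendsto:
  fixes b :: "nat \<Rightarrow> real"
  assumes sub: "\<And>m n. 0 < m \<Longrightarrow> 0 < n \<Longrightarrow> b (m + n) \<le> b m + b n"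
    and mono: "\<And>m n. 0 < m \<Longrightarrow> m \<le> n \<Longrightarrow> b m \<le> b n" and nonneg: "\<And>n. 0 < n \<Longrightarrow> 0 \<le> b n"
  shows "(\<lambda>n. b n / real n) \<longlonglongrightarrow> (INF n\<in>{0<..}. b n / real n)"
proof (rule LIMSEQ_I)
  define l where "l = (INF n\<in>{0<..}. b n / real n)"
  have bdd: "bdd_below ((\<lambda>n. b n / real n) ` {0<..})" using nonneg by (intro bdd_belowI[of _ 0]) auto
  have lower: "l \<le> b n / real n" if "0 < n" for n
    unfolding l_def using that by (intro cINF_lower[OF bdd]) auto
  have mult: "b (q * k) \<le> real q * b k" if "0 < q" "0 < k" for q k
    using that(1)
  proof (induction q rule: nat_induct_non_zero)
    case (Suc q)
    have "b (Suc q * k) \<le> b k + b (q * k)" using sub[of k "q * k"] Suc that by simp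
    then show ?case using Suc.IH by (simp add: algebra_simps)
  qed simp
  fix r :: real assume r: "r > 0"
  obtain k where k: "0 < k" "b k / real k < l + r / 2"
    using cINF_less_iff[OF _ bdd, of "l + r / 2"] r unfolding l_def by auto
  obtain no :: nat where no: "real no > 2 * b k / r" using reals_Archimedean2 by blast
  show "\<exists>no. \<forall>n\<ge>no. norm (b n / real n - (INF n\<in>{0<..}. b n / real n)) < r"
  proof (intro exI[of _ "Suc no"] allI impI)
    fix n assume n: "Suc no \<le> n"
    then have n0: "0 < n" by simp
    have "n \<le> (n div k + 1) * k" using dividend_less_div_times[OF k(1), of n] by (simp add: algebra_simps)
    then have "b n \<le> b ((n div k + 1) * k)" by (rule mono[OF n0])
    also have "\<dots> \<le> real (n div k + 1) * b k" by (rule mult) (use k in auto)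
    also have "\<dots> \<le> (real n / real k + 1) * b k"
      using of_nat_div_le_of_nat[of n k, where 'a = real] nonneg[OF k(1)] by (intro mult_right_mono) auto
    finally have "b n / real n \<le> (real n / real k + 1) * b k / real n" by (rule divide_right_mono) simp
    also have "\<dots> = b k / real k + b k / real n" using n0 k by (simp add: field_simps)
    also have "\<dots> < (l + r / 2) + r / 2"
    proof (rule add_strict_mono[OF k(2)])
      have "2 * b k / r < real n" using no n by linarith
      then show "b k / real n < r / 2" using r n0 by (simp add: field_simps)
    qed
    finally have "b n / real n < l + r" by simp
    then show "norm (b n / real n - (INF n\<in>{0<..}. b n / real n)) < r"
      using lower[OF n0] unfolding l_def[symmetric] by simp
  qed
qed

lemma eps_dim_dyn_metric_average_tendsto:
  assumes S: "continuous_map Y Y S" and ne: "topspace Y \<noteq> {}"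
  shows "\<exists>l. (\<lambda>n. ereal (1 / real n) * eps_dim Y (dyn_metric S \<rho> n) \<epsilon>) \<longlonglongrightarrow> l"
proof -
  define a where "a = (\<lambda>n. eps_dim Y (dyn_metric S \<rho> n) \<epsilon>)"
  have sub: "a (m + n) \<le> a m + a n" if "0 < m" "0 < n" for m n
    unfolding a_def by (rule eps_dim_dyn_metric_subadditive[OF S ne that])
  have mono: "a m \<le> a n" if "0 < m" "m \<le> n" for m n
    unfolding a_def
  proof (rule eps_dim_mono)
    show "dyn_metric S \<rho> m x y \<le> dyn_metric S \<rho> n x y" for x y
      using that dyn_metric_ge[of _ n \<rho> S x y] by (subst dyn_metric_le_iff) auto
  qed
  have nonneg: "0 \<le> a n" for n unfolding a_def by (rule eps_dim_nonneg[OF ne])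
  show ?thesis
  \<comment> \<open>Either all values at positive times are infinite, by monotonicity, or all are
    finite, by subadditivity.\<close>
  proof (cases "a 1 = \<infinity>")
    case True
    have "ereal (1 / real n) * a n = \<infinity>" if "n \<ge> 1" for n
    proof -
      have "a n = \<infinity>" using mono[of 1 n] that True by simp
      then show ?thesis using that by simp
    qed
    then have "\<forall>\<^sub>F n in sequentially. ereal (1 / real n) * a n = \<infinity>"
      using eventually_sequentially by blast
    then have "(\<lambda>n. ereal (1 / real n) * a n) \<longlonglongrightarrow> \<infinity>" by (rule tendsto_eventually)
    then show ?thesis unfolding a_def by blast
  next
    case False
    have fin: "a n < \<infinity>" if "0 < n" for n
      using that
    proof (induction n rule: nat_induct_non_zero)
      case (Suc n)
      have "a (Suc n) \<le> a 1 + a n" using sub[of 1 n] Suc by simp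
      also have "\<dots> < \<infinity>" using False Suc by (simp add: less_top)
      finally show ?case .
    qed (use False in \<open>simp add: less_top\<close>)
    define b where "b = (\<lambda>n. real_of_ereal (a n))"
    have ab: "a n = ereal (b n)" if "0 < n" for n
      using fin[OF that] nonneg[of n] unfolding b_def by (cases "a n") auto
    have "(\<lambda>n. b n / real n) \<longlonglongrightarrow> (INF n\<in>{0<..}. b n / real n)"
    proof (rule subadditive_average_tendsto)
      show "b (m + n) \<le> b m + b n" if "0 < m" "0 < n" for m n
        using sub[OF that] ab that by simp
      show "b m \<le> b n" if "0 < m" "m \<le> n" for m n
        using mono[OF that] ab that by simp
      show "0 \<le> b n" for n unfolding b_def using nonneg[of n] by (rule real_of_ereal_pos)
    qed
    then have "(\<lambda>n. ereal (b n / real n)) \<longlonglongrightarrow> ereal (INF n\<in>{0<..}. b n / real n)" by simp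
    moreover have "\<forall>\<^sub>F n in sequentially. ereal (b n / real n) = ereal (1 / real n) * a n"
      unfolding eventually_sequentially by (intro exI[of _ 1]) (auto simp: ab)
    ultimately have "(\<lambda>n. ereal (1 / real n) * a n) \<longlonglongrightarrow> ereal (INF n\<in>{0<..}. b n / real n)"
      by (rule Lim_transform_eventually)
    then show ?thesis unfolding a_def by blast
  qed
qed

text \<open>Entropy is a limsup and yields good times only infinitely often; existence of the limit
  makes this sufficient.\<close>

lemma mdim_eps_ge:
  assumes S: "continuous_map Y Y S" and ne: "topspace Y \<noteq> {}"
    and freq: "\<exists>\<^sub>F n in sequentially. c \<le> ereal (1 / real n) * eps_dim Y (dyn_metric S \<rho> n) \<epsilon>"
  shows "c \<le> mdim_eps Y \<rho> S \<epsilon>"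
proof -
  obtain l where l: "(\<lambda>n. ereal (1 / real n) * eps_dim Y (dyn_metric S \<rho> n) \<epsilon>) \<longlonglongrightarrow> l"
    using eps_dim_dyn_metric_average_tendsto[OF S ne] by blast
  then have "mdim_eps Y \<rho> S \<epsilon> = l" unfolding mdim_eps_def by (rule limI)
  moreover have "c \<le> l"
  proof (rule ccontr)
    assume "\<not> c \<le> l"
    then have "\<forall>\<^sub>F n in sequentially. ereal (1 / real n) * eps_dim Y (dyn_metric S \<rho> n) \<epsilon> < c"
      by (intro order_tendstoD(2)[OF l]) simp
    then show False using freq by (simp add: frequently_def not_le)
  qed
  ultimately show ?thesis by simp
qed

section \<open>The lower bound\<close>

text \<open>The cube has \<open>M * k\<close> coordinates. A change in one of them from 0 to 1 is
  detected at the start \<beta> b of its block, where the words are \<open>r / L ^ m\<close> apart;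
  the factor \<open>1 / 2 ^ q\<close> is the range of a word's probability.\<close>

lemma mdim_eps_push_forward_ge:
  fixes T :: "'a::metric_space \<Rightarrow> 'a"
  assumes compact: "compact (UNIV :: 'a set)" and L: "L-lipschitz_on UNIV T" "L \<ge> 1"
    and r: "r > 0" and c: "c > 0"
    and freq: "\<exists>\<^sub>F n in sequentially.
           \<exists>y W. W \<subseteq> {..<n} \<and> c * real n < real (card W) \<and> shatters (range (ball_code T r y)) W"
    and m: "m > 0" and q: "q > 0" "2 * real q \<le> c * real m"
    and \<epsilon>: "\<epsilon> \<le> r / (L ^ m * 2 ^ q)"
  shows "ereal (c / (4 * real m) * (2 ^ q - 1)) \<le> mdim_eps weak_star W1 (push_forward T) \<epsilon>"
proof (rule mdim_eps_ge)
  have T: "continuous_on UNIV T" by (rule lipschitz_on_continuous_on[OF L(1)])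
  show "continuous_map weak_star weak_star (push_forward T)" by (rule continuous_map_push_forward[OF T])
  have "distr (measure_pmf (return_pmf ())) borel (\<lambda>_. undefined :: 'a) \<in> topspace weak_star"
    unfolding topspace_weak_star by (rule distr_in_borel_probs)
  then show "topspace (weak_star :: 'a measure topology) \<noteq> {}" by blast
  \<comment> \<open>There are \<open>2 ^ q\<close> words per block, and one of them absorbs the
    remaining probability, so \<open>k\<close> weights are free.\<close>
  define k :: nat where "k = 2 ^ q - 1"
  have k1: "real k + 1 = 2 ^ q" "real k = 2 ^ q - 1" unfolding k_def by (auto simp: of_nat_diff)
  have "(2::nat) ^ 1 \<le> 2 ^ q" using q(1) by (intro power_increasing) auto
  then have k0: "k > 0" unfolding k_def by simp
  have bound: "ereal (c / (4 * real m) * (2 ^ q - 1)) \<le>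
      ereal (1 / real n) * eps_dim weak_star (dyn_metric (push_forward T) W1 n) \<epsilon>"
    if W: "W \<subseteq> {..<n}" "c * real n < real (card W)" "shatters (range (ball_code T r y)) W"
      and n: "n \<ge> 2 * m" for n y W
  proof -
    obtain M \<beta> x where M: "c * real n / (4 * real m) \<le> real M" and \<beta>: "\<forall>b<M. \<beta> b < n"
      and sep: "\<forall>b<M. \<forall>s s' :: nat \<Rightarrow> nat. s b < 2 ^ q \<longrightarrow> s' b < 2 ^ q \<longrightarrow> s b \<noteq> s' b \<longrightarrow>
        r / L ^ m \<le> dist ((T ^^ \<beta> b) (x s)) ((T ^^ \<beta> b) (x s'))"
      using free_words[OF L r W m n q] by blast
    define h where "h = (\<lambda>t. distr (measure_pmf (cube_law M k t)) borel x)"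
    have "ereal (real (M * k)) \<le> eps_dim weak_star (dyn_metric (push_forward T) W1 n) \<epsilon>"
    proof (rule eps_dim_ge_unit_cube)
      show "continuous_map (top_of_set (unit_cube (M * k))) weak_star h"
        unfolding h_def by (rule continuous_map_cube_measure)
      fix i t t' assume i: "i < M * k" and t: "t \<in> unit_cube (M * k)" "t' \<in> unit_cube (M * k)" "t i = 0" "t' i = 1"
      define b where "b = i div k"
      define w where "w = i mod k"
      have bw: "b < M" "w < k" "b * k + w = i"
        using i k0 by (auto simp: b_def w_def less_mult_imp_div_less)
      have "r / L ^ m / (real k + 1) * \<bar>t (b * k + w) - t' (b * k + w)\<bar> \<le>
          W1 (distr (cube_law M k t) borel (\<lambda>s. (T ^^ \<beta> b) (x s))) (distr (cube_law M k t') borel (\<lambda>s. (T ^^ \<beta> b) (x s)))"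
      proof (rule W1_cube_measures_ge[OF compact _ _ t(1,2) bw(1,2)])
        show "0 < r / L ^ m" using r L(2) by simp
        show "r / L ^ m \<le> dist ((T ^^ \<beta> b) (x s)) ((T ^^ \<beta> b) (x s'))"
          if "s b \<le> k" "s' b \<le> k" "s b \<noteq> s' b" for s s'
        proof -
          have "s b < 2 ^ q" "s' b < 2 ^ q" using that k0 unfolding k_def by auto
          then show ?thesis using sep bw(1) that(3) by blast
        qed
      qed
      also have "\<dots> = W1 ((push_forward T ^^ \<beta> b) (h t)) ((push_forward T ^^ \<beta> b) (h t'))"
        unfolding h_def push_forward_funpow_distr_pmf[OF T] ..
      also have "\<dots> \<le> dyn_metric (push_forward T) W1 n (h t) (h t')"
        by (rule dyn_metric_ge) (use \<beta> bw(1) in blast)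
      finally have "r / L ^ m / 2 ^ q \<le> dyn_metric (push_forward T) W1 n (h t) (h t')"
        unfolding bw(3) t(3,4) k1(1) by simp
      then show "\<epsilon> \<le> dyn_metric (push_forward T) W1 n (h t) (h t')" using \<epsilon> by simp
    qed
    then have "ereal (1 / real n) * ereal (real (M * k)) \<le>
        ereal (1 / real n) * eps_dim weak_star (dyn_metric (push_forward T) W1 n) \<epsilon>"
      by (rule ereal_mult_left_mono) simp
    moreover have "c / (4 * real m) * (2 ^ q - 1) \<le> 1 / real n * real (M * k)"
    proof -
      have n0: "real n > 0" using n m by simp
      have "c / (4 * real m) = 1 / real n * (c * real n / (4 * real m))" using n0 by simp
      also have "\<dots> \<le> 1 / real n * real M" using M n0 by (intro mult_left_mono) auto
      finally have "c / (4 * real m) * real k \<le> 1 / real n * real M * real k" by (rule mult_right_mono) simp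
      then show ?thesis unfolding k1(2)[symmetric] by simp
    qed
    then have "ereal (c / (4 * real m) * (2 ^ q - 1)) \<le> ereal (1 / real n) * ereal (real (M * k))" by simp
    ultimately show ?thesis by (rule order_trans[rotated])
  qed
  have "\<forall>\<^sub>F n in sequentially. n \<ge> 2 * m" by (rule eventually_ge_at_top)
  with freq show "\<exists>\<^sub>F n in sequentially. ereal (c / (4 * real m) * (2 ^ q - 1)) \<le>
      ereal (1 / real n) * eps_dim weak_star (dyn_metric (push_forward T) W1 n) \<epsilon>"
    by (rule frequently_rev_mp[OF _ eventually_mono]) (rule impI, elim exE conjE, rule bound)
qed

text \<open>Take \<open>m\<close> near \<open>ln (r / \<epsilon>) / ln K\<close> and
  \<open>q\<close> near \<open>c * m / 2\<close>, so that \<open>2 ^ q\<close> is comparable to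
  \<open>exp (a * m)\<close>. The division by \<open>m\<close> is absorbed by
  \<open>y \<le> exp y\<close> at \<open>y = a * m / 2\<close>, which leaves
  \<open>exp (a * m / 2)\<close>, a power of \<open>1 / \<epsilon>\<close> with exponent
  \<alpha>.\<close>

lemma scale_choice:
  fixes c r K :: real
  assumes c: "0 < c" "c \<le> 1" and r: "0 < r" and K: "1 < K"
  shows "\<exists>C \<alpha> \<epsilon>\<^sub>0. C > 0 \<and> \<alpha> > 0 \<and> \<epsilon>\<^sub>0 > 0 \<and> (\<forall>\<epsilon>. 0 < \<epsilon> \<and> \<epsilon> < \<epsilon>\<^sub>0 \<longrightarrow>
     (\<exists>m q :: nat. 0 < m \<and> 0 < q \<and> 2 * real q \<le> c * real m \<and> \<epsilon> \<le> r / K ^ m \<and>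
        C * \<epsilon> powr (- \<alpha>) \<le> c / (4 * real m) * (2 ^ q - 1)))"
proof -
  define a where "a = c * ln 2 / 2"
  have a: "a > 0" using c by (simp add: a_def)
  have lnK: "ln K > 0" using K by simp
  define \<alpha> where "\<alpha> = a / (2 * ln K)"
  have \<alpha>: "\<alpha> > 0" using a lnK by (simp add: \<alpha>_def)
  \<comment> \<open>The 16 combines the given 4 with
    \<open>exp (a * m) \<le> 4 * (2 ^ q - 1)\<close>; \<open>a / 2\<close> comes from absorbing
    \<open>m\<close>, \<open>exp (- a / 2)\<close> from rounding \<open>m\<close> down, and
    \<open>r powr \<alpha>\<close> from measuring \<epsilon> relative to \<open>r\<close>.\<close>
  define C where "C = c / 16 * (a / 2 * exp (- a / 2) * r powr \<alpha>)"
  have C: "C > 0" using c a r by (simp add: C_def)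
  \<comment> \<open>Below this threshold \<open>m\<close> exceeds \<open>2 / c\<close>, hence
    \<open>c * m / 2 > 1\<close> and \<open>q\<close> is positive.\<close>
  define \<epsilon>\<^sub>0 where "\<epsilon>\<^sub>0 = r / exp ((2 / c + 1) * ln K)"
  have \<epsilon>\<^sub>0: "\<epsilon>\<^sub>0 > 0" using r by (simp add: \<epsilon>\<^sub>0_def)
  have "\<exists>m q :: nat. 0 < m \<and> 0 < q \<and> 2 * real q \<le> c * real m \<and> \<epsilon> \<le> r / K ^ m \<and>
        C * \<epsilon> powr (- \<alpha>) \<le> c / (4 * real m) * (2 ^ q - 1)" if \<epsilon>: "0 < \<epsilon>" "\<epsilon> < \<epsilon>\<^sub>0" for \<epsilon>
  proof -
    define X where "X = ln (r / \<epsilon>)"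
    have expX: "exp X = r / \<epsilon>" using r \<epsilon>(1) by (simp add: X_def)
    have "exp ((2 / c + 1) * ln K) < r / \<epsilon>" using \<epsilon> r unfolding \<epsilon>\<^sub>0_def by (simp add: field_simps)
    then have "(2 / c + 1) * ln K < X" unfolding expX[symmetric] by simp
    then have X1: "2 / c + 1 < X / ln K" using lnK by (simp add: field_simps)
    define m where "m = nat \<lfloor>X / ln K\<rfloor>"
    define q where "q = nat \<lfloor>c * real m / 2\<rfloor>"
    have "X / ln K > 0" using X1 c by (smt (verit) divide_pos_pos)
    then have m: "real m \<le> X / ln K" "X / ln K < real m + 1" unfolding m_def by linarith+
    have "2 / c < real m" using m X1 by linarith
    then have cm: "2 < c * real m" using c by (simp add: field_simps)
    then have m0: "m > 0" by (cases m) auto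
    have q: "real q \<le> c * real m / 2" "c * real m / 2 < real q + 1" "q > 0"
      using cm unfolding q_def by linarith+
    have "K ^ m = exp (real m * ln K)" using K by (simp add: exp_of_nat_mult)
    also have "\<dots> \<le> exp X" using m(1) lnK by (simp add: field_simps)
    finally have "K ^ m \<le> r / \<epsilon>" unfolding expX .
    then have \<epsilon>K: "\<epsilon> \<le> r / K ^ m" using \<epsilon>(1) K by (simp add: field_simps)
    have "C * \<epsilon> powr (- \<alpha>) = c / 16 * (a / 2 * exp (\<alpha> * X - a / 2))"
    proof -
      have "r powr \<alpha> * \<epsilon> powr (- \<alpha>) = exp (\<alpha> * X)"
        unfolding X_def using r \<epsilon>(1) by (simp add: powr_def ln_div exp_add[symmetric] algebra_simps)
      then show ?thesis unfolding C_def exp_diff exp_minus[of "a / 2"] by (simp add: exp_minus field_simps)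
    qed
    also have "\<alpha> * X - a / 2 \<le> a * real m / 2"
    proof -
      have "\<alpha> * X = a / 2 * (X / ln K)" by (simp add: \<alpha>_def)
      also have "\<dots> \<le> a / 2 * (real m + 1)" using m(2) a by (intro mult_left_mono) auto
      finally show ?thesis by (simp add: algebra_simps)
    qed
    also have "a / 2 * exp (a * real m / 2) \<le> exp (a * real m) / real m"
    proof -
      have "a * real m / 2 \<le> exp (a * real m / 2)" using exp_ge_add_one_self[of "a * real m / 2"] by linarith
      then have "a * real m / 2 * exp (a * real m / 2) \<le> exp (a * real m / 2) * exp (a * real m / 2)"
        by (intro mult_right_mono) auto
      also have "\<dots> = exp (a * real m)" by (simp add: exp_add[symmetric])
      finally show ?thesis using m0 by (simp add: field_simps)
    qed
    also have "c / 16 * (exp (a * real m) / real m) \<le> c / (4 * real m) * (2 ^ q - 1)"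
    proof -
      have "exp (a * real m) \<le> exp ((real q + 1) * ln 2)"
        using mult_right_mono[OF less_imp_le[OF q(2)], of "ln 2"] unfolding a_def by (simp add: algebra_simps)
      also have "\<dots> = 2 * 2 ^ q" by (simp add: exp_add exp_of_nat_mult algebra_simps)
      finally have 1: "exp (a * real m) \<le> 2 * 2 ^ q" .
      have "(2::real) ^ 1 \<le> 2 ^ q" using q(3) by (intro power_increasing) auto
      then have "exp (a * real m) \<le> 4 * (2 ^ q - 1)" using 1 by simp
      then have 2: "c / (16 * real m) * exp (a * real m) \<le> c / (16 * real m) * (4 * (2 ^ q - 1))"
        using c by (intro mult_left_mono) auto
      have 3: "c / (16 * real m) * (4 * Q) = c / (4 * real m) * Q" for Q by simp
      have "c / 16 * (exp (a * real m) / real m) = c / (16 * real m) * exp (a * real m)" by simp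
      then show ?thesis using 2 unfolding 3 by (rule ord_eq_le_trans)
    qed
    finally have "C * \<epsilon> powr (- \<alpha>) \<le> c / (4 * real m) * (2 ^ q - 1)" using c a by simp
    then show ?thesis using m0 q \<epsilon>K by (intro exI[of _ m] exI[of _ q]) auto
  qed
  then show ?thesis using C \<alpha> \<epsilon>\<^sub>0 by blast
qed

text \<open>The range ends at a threshold instead of 1 because scales are relative to the metric: if
  \<epsilon> exceeds the diameter of the space, the constant map to a point is admissible for every
  \<open>n\<close> and the mean dimension at scale \<epsilon> is 0.\<close>

theorem theorem1:
  fixes T :: "'a::metric_space \<Rightarrow> 'a"
  assumes "compact (UNIV :: 'a set)"
    and "\<exists>L. L-lipschitz_on UNIV T"
    and "topological_entropy T > 0"
  shows "\<exists>C \<alpha> \<epsilon>\<^sub>0 :: real. C > 0 \<and> \<alpha> > 0 \<and> \<epsilon>\<^sub>0 > 0 \<and>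
    (\<forall>\<epsilon>. 0 < \<epsilon> \<and> \<epsilon> < \<epsilon>\<^sub>0 \<longrightarrow>
       mdim_eps weak_star W1 (push_forward T) \<epsilon> \<ge> ereal (C * \<epsilon> powr (- \<alpha>)))"
proof -
  obtain L0 where L0: "L0-lipschitz_on UNIV T" using assms(2) by blast
  define L where "L = max 1 L0"
  have L: "L-lipschitz_on UNIV T" "L \<ge> 1" using lipschitz_on_mono[OF L0 subset_UNIV, of L] unfolding L_def by auto
  obtain r c0 where r: "r > 0" and c0: "c0 > 0" and freq0: "\<exists>\<^sub>F n in sequentially.
      \<exists>y W. W \<subseteq> {..<n} \<and> c0 * real n < real (card W) \<and> shatters (range (ball_code T r y)) W"
    using positive_entropy_shatters[OF assms(1,3)] by blast
  \<comment> \<open>With \<open>c \<le> 1\<close> one has \<open>q \<le> m\<close>, so the two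
    losses \<open>L ^ m\<close> and \<open>2 ^ q\<close> together are at most
    \<open>(2 * L) ^ m\<close>; this is the base \<open>K = 2 * L\<close> of the choice of
    scale.\<close>
  define c where "c = min 1 c0"
  have c: "0 < c" "c \<le> 1" using c0 by (auto simp: c_def)
  have "c * real n \<le> c0 * real n" for n unfolding c_def by (intro mult_right_mono) auto
  then have freq: "\<exists>\<^sub>F n in sequentially.
      \<exists>y W. W \<subseteq> {..<n} \<and> c * real n < real (card W) \<and> shatters (range (ball_code T r y)) W"
    by (intro frequently_elim1[OF freq0]) (meson le_less_trans)
  obtain C \<alpha> \<epsilon>\<^sub>0 where C: "C > 0" "\<alpha> > 0" "\<epsilon>\<^sub>0 > 0" and choice: "\<forall>\<epsilon>. 0 < \<epsilon> \<and> \<epsilon> < \<epsilon>\<^sub>0 \<longrightarrow>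
     (\<exists>m q :: nat. 0 < m \<and> 0 < q \<and> 2 * real q \<le> c * real m \<and> \<epsilon> \<le> r / (2 * L) ^ m \<and>
        C * \<epsilon> powr (- \<alpha>) \<le> c / (4 * real m) * (2 ^ q - 1))"
    using scale_choice[OF c r, of "2 * L"] L(2) by auto
  have "ereal (C * \<epsilon> powr (- \<alpha>)) \<le> mdim_eps weak_star W1 (push_forward T) \<epsilon>" if "0 < \<epsilon>" "\<epsilon> < \<epsilon>\<^sub>0" for \<epsilon>
  proof -
    obtain m q :: nat where mq: "0 < m" "0 < q" "2 * real q \<le> c * real m" "\<epsilon> \<le> r / (2 * L) ^ m"
        "C * \<epsilon> powr (- \<alpha>) \<le> c / (4 * real m) * (2 ^ q - 1)"
      using choice \<open>0 < \<epsilon>\<close> \<open>\<epsilon> < \<epsilon>\<^sub>0\<close> by blast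
    have "c * real m \<le> real m" using c by (simp add: mult_left_le_one_le)
    then have "q \<le> m" using mq(3) by linarith
    then have "L ^ m * 2 ^ q \<le> L ^ m * 2 ^ m" using L(2) by (intro mult_left_mono power_increasing) auto
    also have "\<dots> = (2 * L) ^ m" by (simp add: power_mult_distrib)
    finally have "r / (2 * L) ^ m \<le> r / (L ^ m * 2 ^ q)" using r L(2) by (intro divide_left_mono) auto
    then have "\<epsilon> \<le> r / (L ^ m * 2 ^ q)" using mq(4) by linarith
    from mdim_eps_push_forward_ge[OF assms(1) L r c(1) freq mq(1-3) this] show ?thesis
      using mq(5) by (meson ereal_less_eq(3) order_trans)
  qed
  then show ?thesis using C by blast
qed

end
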